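(* Let $(F^4,g)$ be the Riemannian manifold described in the context, with global coordinates $(x,y,s,t)$, $t>0$. A smooth vector field $\xi$ on $F^4$ is a Ricci soliton vector field, i.e. there exists a constant $\lambda\in\mathbb{R}$ with $$\mathrm{Ric}+\tfrac12\mathcal{L}_\xi g=\lambda g ,$$ if and only if there exist constants $c_1,\dots,c_5\in\mathbb{R}$ such that $$\begin{aligned} \xi={}&\tfrac12\left[(c_2-12)x+2c_3\,y+2c_5\right]\frac{\partial}{\partial x} -\tfrac12\left[c_1\,x+(c_2+12)y-2c_4\right]\frac{\partial}{\partial y}\\ &+\tfrac12\left[c_1(s^2-t^2)+2c_2\,s+2c_3\right]\frac{\partial}{\partial s} +(c_1\,s+c_2)\,t\,\frac{\partial}{\partial t}. \end{aligned}$$ Moreover, in this case the Ricci soliton $(F^4,g,\xi,\lambda)$ is expanding with $\lambda=-6$.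
   Context: $F^4=\mathbb{R}^2\times\mathbb{H}^2$ with global coordinates $(x,y,s,t)$, where $(x,y)\in\mathbb{R}^2$ and $(s,t)$, $t>0$, are upper half-plane coordinates on $\mathbb{H}^2$. The Riemannian metric is $g=\theta_1^2+\theta_2^2+\theta_3^2+\theta_4^2$ with $$\theta_1=\tfrac{1}{\sqrt t}dx-\tfrac{s}{\sqrt t}dy,\quad \theta_2=\sqrt t\,dy,\quad \theta_3=\tfrac{1}{2t}ds,\quad \theta_4=\tfrac{1}{2t}dt,$$ so that the frame $e_1=\sqrt t\,\partial_x$, $e_2=\frac{s}{\sqrt t}\partial_x+\frac{1}{\sqrt t}\partial_y$, $e_3=2t\,\partial_s$, $e_4=2t\,\partial_t$ is orthonormal. The curvature conventions are $R(X,Y)Z=\nabla_X\nabla_YZ-\nabla_Y\nabla_XZ-\nabla_{[X,Y]}Z$ and $\mathrm{Ric}(X,Y)=\sum_{i=1}^4 g(R(X,e_i)e_i,Y)$, where $\nabla$ is the Levi-Civita connection of $g$. $\mathcal{L}_\xi g$ is the Lie derivative of $g$ along $\xi$. A Ricci soliton is called expanding if $\lambda<0$. *)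

theory Defs
  imports "HOL-Analysis.Analysis"
begin

section \<open>Calculus on an open subset of a Euclidean space\<close>

text \<open>
  A manifold with global coordinates is an open set \<open>S\<close>. A vector field is represented by the
  function of its components with respect to the coordinate fields. Functions and vector fields are
  total in HOL; only their values on \<open>S\<close> are meaningful.
\<close>

text \<open>For open \<open>S\<close> in a finite-dimensional space, \<open>Ck_on k S f\<close> says that \<open>f\<close> is \<open>C\<^sup>k\<close> on \<open>S\<close>.\<close>

fun Ck_on :: "nat \<Rightarrow> 'a::real_normed_vector set \<Rightarrow> ('a \<Rightarrow> 'b::real_normed_vector) \<Rightarrow> bool" where
  "Ck_on 0 S f \<longleftrightarrow> continuous_on S f"
| "Ck_on (Suc k) S f \<longleftrightarrow>
     (\<forall>p\<in>S. f differentiable (at p)) \<and> (\<forall>v. Ck_on k S (\<lambda>p. frechet_derivative f (at p) v))"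

definition smooth_on :: "'a::real_normed_vector set \<Rightarrow> ('a \<Rightarrow> 'b::real_normed_vector) \<Rightarrow> bool" where
  "smooth_on S f \<longleftrightarrow> (\<forall>k. Ck_on k S f)"

definition vderiv :: "('a::real_normed_vector \<Rightarrow> 'a) \<Rightarrow> ('a \<Rightarrow> 'b::real_normed_vector) \<Rightarrow> 'a \<Rightarrow> 'b" where
  "vderiv X f p = frechet_derivative f (at p) (X p)"

definition lie_bracket :: "('a::real_normed_vector \<Rightarrow> 'a) \<Rightarrow> ('a \<Rightarrow> 'a) \<Rightarrow> 'a \<Rightarrow> 'a" where
  "lie_bracket X Y p = vderiv X Y p - vderiv Y X p"

section \<open>Riemannian notions\<close>

text \<open>A metric \<open>g\<close> takes a point and two tangent vectors at that point.\<close>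

type_synonym 'a metric = "'a \<Rightarrow> 'a \<Rightarrow> 'a \<Rightarrow> real"
type_synonym 'a vfield = "'a \<Rightarrow> 'a"

text \<open>
  The second clause says that a connection is a map on vector fields over \<open>S\<close>: it does not see the
  irrelevant values outside \<open>S\<close>.
\<close>

definition affine_connection ::
  "'a::real_normed_vector set \<Rightarrow> ('a vfield \<Rightarrow> 'a vfield \<Rightarrow> 'a vfield) \<Rightarrow> bool" where
  "affine_connection S D \<longleftrightarrow>
     (\<forall>X Y. smooth_on S X \<and> smooth_on S Y \<longrightarrow> smooth_on S (D X Y)) \<and>
     (\<forall>X X' Y Y'. smooth_on S X \<and> smooth_on S X' \<and> smooth_on S Y \<and> smooth_on S Y' \<and>
        (\<forall>p\<in>S. X p = X' p \<and> Y p = Y' p) \<longrightarrow> (\<forall>p\<in>S. D X Y p = D X' Y' p)) \<and>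
     (\<forall>X X' Y. smooth_on S X \<and> smooth_on S X' \<and> smooth_on S Y \<longrightarrow>
        (\<forall>p\<in>S. D (\<lambda>q. X q + X' q) Y p = D X Y p + D X' Y p)) \<and>
     (\<forall>f X Y. smooth_on S f \<and> smooth_on S X \<and> smooth_on S Y \<longrightarrow>
        (\<forall>p\<in>S. D (\<lambda>q. f q *\<^sub>R X q) Y p = f p *\<^sub>R D X Y p)) \<and>
     (\<forall>X Y Y'. smooth_on S X \<and> smooth_on S Y \<and> smooth_on S Y' \<longrightarrow>
        (\<forall>p\<in>S. D X (\<lambda>q. Y q + Y' q) p = D X Y p + D X Y' p)) \<and>
     (\<forall>f X Y. smooth_on S f \<and> smooth_on S X \<and> smooth_on S Y \<longrightarrow>
        (\<forall>p\<in>S. D X (\<lambda>q. f q *\<^sub>R Y q) p = vderiv X f p *\<^sub>R Y p + f p *\<^sub>R D X Y p))"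

definition levi_civita ::
  "'a::real_normed_vector set \<Rightarrow> 'a metric \<Rightarrow> ('a vfield \<Rightarrow> 'a vfield \<Rightarrow> 'a vfield) \<Rightarrow> bool" where
  "levi_civita S g D \<longleftrightarrow>
     affine_connection S D \<and>
     (\<forall>X Y. smooth_on S X \<and> smooth_on S Y \<longrightarrow>
        (\<forall>p\<in>S. D X Y p - D Y X p = lie_bracket X Y p)) \<and>
     (\<forall>X Y Z. smooth_on S X \<and> smooth_on S Y \<and> smooth_on S Z \<longrightarrow>
        (\<forall>p\<in>S. vderiv X (\<lambda>q. g q (Y q) (Z q)) p
               = g p (D X Y p) (Z p) + g p (Y p) (D X Z p)))"

definition curvature ::
  "('a vfield \<Rightarrow> 'a vfield \<Rightarrow> 'a vfield) \<Rightarrow>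
   'a vfield \<Rightarrow> 'a vfield \<Rightarrow> 'a vfield \<Rightarrow> 'a::real_normed_vector vfield" where
  "curvature D X Y Z p = D X (D Y Z) p - D Y (D X Z) p - D (lie_bracket X Y) Z p"

text \<open>\<open>Es\<close> is meant to be a \<open>g\<close>-orthonormal frame; see \<open>frameF4_orthonormal\<close> below.\<close>

definition ricci ::
  "'a metric \<Rightarrow> ('a vfield \<Rightarrow> 'a vfield \<Rightarrow> 'a vfield) \<Rightarrow> 'a::real_normed_vector vfield list \<Rightarrow>
   'a vfield \<Rightarrow> 'a vfield \<Rightarrow> 'a \<Rightarrow> real" where
  "ricci g D Es X Y p = (\<Sum>E\<leftarrow>Es. g p (curvature D X E E p) (Y p))"

definition lie_deriv_metric ::
  "'a::real_normed_vector vfield \<Rightarrow> 'a metric \<Rightarrow> 'a vfield \<Rightarrow> 'a vfield \<Rightarrow> 'a \<Rightarrow> real" where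
  "lie_deriv_metric \<xi> g X Y p =
     vderiv \<xi> (\<lambda>q. g q (X q) (Y q)) p
     - g p (lie_bracket \<xi> X p) (Y p) - g p (X p) (lie_bracket \<xi> Y p)"

definition ricci_soliton ::
  "'a::real_normed_vector set \<Rightarrow> 'a metric \<Rightarrow> ('a vfield \<Rightarrow> 'a vfield \<Rightarrow> 'a vfield) \<Rightarrow>
   'a vfield list \<Rightarrow> 'a vfield \<Rightarrow> real \<Rightarrow> bool" where
  "ricci_soliton S g D Es \<xi> \<mu> \<longleftrightarrow>
     smooth_on S \<xi> \<and>
     (\<forall>X Y. smooth_on S X \<and> smooth_on S Y \<longrightarrow>
        (\<forall>p\<in>S. ricci g D Es X Y p + 1/2 * lie_deriv_metric \<xi> g X Y p = \<mu> * g p (X p) (Y p)))"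

definition expanding_ricci_soliton ::
  "'a::real_normed_vector set \<Rightarrow> 'a metric \<Rightarrow> ('a vfield \<Rightarrow> 'a vfield \<Rightarrow> 'a vfield) \<Rightarrow>
   'a vfield list \<Rightarrow> 'a vfield \<Rightarrow> real \<Rightarrow> bool" where
  "expanding_ricci_soliton S g D Es \<xi> \<mu> \<longleftrightarrow> ricci_soliton S g D Es \<xi> \<mu> \<and> \<mu> < 0"

section \<open>The manifold \<open>F\<^sup>4\<close>\<close>

text \<open>
  Points are \<open>(x, y, s, t)\<close>; the tangent vector \<open>(a, b, c, d)\<close> stands for
  \<open>a \<partial>\<^sub>x + b \<partial>\<^sub>y + c \<partial>\<^sub>s + d \<partial>\<^sub>t\<close>.
\<close>

type_synonym pt4 = "real \<times> real \<times> real \<times> real"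

definition F4 :: "pt4 set" where
  "F4 = {(x, y, s, t). t > 0}"

definition theta1 :: "pt4 \<Rightarrow> pt4 \<Rightarrow> real" where
  "theta1 = (\<lambda>(x, y, s, t) (a, b, c, d). 1 / sqrt t * a - s / sqrt t * b)"

definition theta2 :: "pt4 \<Rightarrow> pt4 \<Rightarrow> real" where
  "theta2 = (\<lambda>(x, y, s, t) (a, b, c, d). sqrt t * b)"

definition theta3 :: "pt4 \<Rightarrow> pt4 \<Rightarrow> real" where
  "theta3 = (\<lambda>(x, y, s, t) (a, b, c, d). 1 / (2 * t) * c)"

definition theta4 :: "pt4 \<Rightarrow> pt4 \<Rightarrow> real" where
  "theta4 = (\<lambda>(x, y, s, t) (a, b, c, d). 1 / (2 * t) * d)"

definition gF4 :: "pt4 metric" where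
  "gF4 p u v = theta1 p u * theta1 p v + theta2 p u * theta2 p v
             + theta3 p u * theta3 p v + theta4 p u * theta4 p v"

definition e1 :: "pt4 vfield" where
  "e1 = (\<lambda>(x, y, s, t). (sqrt t, 0, 0, 0))"

definition e2 :: "pt4 vfield" where
  "e2 = (\<lambda>(x, y, s, t). (s / sqrt t, 1 / sqrt t, 0, 0))"

definition e3 :: "pt4 vfield" where
  "e3 = (\<lambda>(x, y, s, t). (0, 0, 2 * t, 0))"

definition e4 :: "pt4 vfield" where
  "e4 = (\<lambda>(x, y, s, t). (0, 0, 0, 2 * t))"

abbreviation frameF4 :: "pt4 vfield list" where
  "frameF4 \<equiv> [e1, e2, e3, e4]"

lemma frameF4_orthonormal:
  assumes "p \<in> F4" "i < 4" "j < 4"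
  shows "gF4 p ((frameF4 ! i) p) ((frameF4 ! j) p) = (if i = j then 1 else 0)"
proof -
  have "i = 0 \<or> i = 1 \<or> i = 2 \<or> i = 3" "j = 0 \<or> j = 1 \<or> j = 2 \<or> j = 3"
    using assms by auto
  then show ?thesis
    using assms(1)
    by (auto simp: F4_def gF4_def theta1_def theta2_def theta3_def theta4_def
        e1_def e2_def e3_def e4_def)
qed

section \<open>Existence of the Levi-Civita connection\<close>

lemma open_F4: "open F4"
proof -
  have "F4 = {p. snd (snd (snd p)) > 0}"
    by (auto simp: F4_def)
  moreover have "open {p::pt4. snd (snd (snd p)) > 0}"
    by (intro open_Collect_less continuous_intros)
  ultimately show ?thesis by simp
qed

lemma frechet_derivative_cong_open:
  assumes "open S" "p \<in> S" "\<And>q. q \<in> S \<Longrightarrow> f q = h q" "f differentiable (at p)"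
  shows "h differentiable (at p)" "frechet_derivative h (at p) = frechet_derivative f (at p)"
proof -
  have "(f has_derivative frechet_derivative f (at p)) (at p)"
    using assms(4) frechet_derivative_works by blast
  then have *: "(h has_derivative frechet_derivative f (at p)) (at p)"
    using assms(1-3) by (rule has_derivative_transform_within_open)
  then show "h differentiable (at p)" "frechet_derivative h (at p) = frechet_derivative f (at p)"
    by (auto simp: differentiable_def frechet_derivative_at[symmetric])
qed

lemma Ck_on_cong:
  assumes "open S" "Ck_on k S f" "\<And>q. q \<in> S \<Longrightarrow> f q = h q"
  shows "Ck_on k S h"
  using assms(2,3)
proof (induction k arbitrary: f h)
  case 0
  then show ?case unfolding Ck_on.simps using continuous_on_eq by blast
next
  case (Suc k)
  have f: "f differentiable (at p)" if "p \<in> S" for p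
    using Suc.prems(1) that by simp
  have d: "h differentiable (at p)" if "p \<in> S" for p
    by (rule frechet_derivative_cong_open(1)[of S p f h]) (use assms(1) that Suc.prems(2) f in blast)+
  have e: "frechet_derivative h (at p) = frechet_derivative f (at p)" if "p \<in> S" for p
    by (rule frechet_derivative_cong_open(2)[of S p f h]) (use assms(1) that Suc.prems(2) f in blast)+
  have "Ck_on k S (\<lambda>p. frechet_derivative h (at p) v)" for v
  proof (rule Suc.IH)
    show "Ck_on k S (\<lambda>p. frechet_derivative f (at p) v)" using Suc.prems(1) by simp
  qed (simp add: e)
  then show ?case using d by simp
qed

lemma Ck_on_SucD: "Ck_on (Suc k) S f \<Longrightarrow> Ck_on k S f"
proof (induction k arbitrary: f)
  case 0
  then have "\<forall>p\<in>S. isCont f p" using differentiable_imp_continuous_within by auto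
  then show ?case by (simp add: continuous_at_imp_continuous_on)
next
  case (Suc k)
  then show ?case by (metis Ck_on.simps(2))
qed

lemma smooth_onD:
  assumes "smooth_on S f"
  shows "p \<in> S \<Longrightarrow> f differentiable (at p)"
    and "p \<in> S \<Longrightarrow> (f has_derivative frechet_derivative f (at p)) (at p)"
    and "smooth_on S (\<lambda>p. frechet_derivative f (at p) v)"
    and "Ck_on k S f"
proof -
  show *: "f differentiable (at p)" if "p \<in> S" for p
    using assms that unfolding smooth_on_def by (metis Ck_on.simps(2))
  show "(f has_derivative frechet_derivative f (at p)) (at p)" if "p \<in> S" for p
    using *[OF that] frechet_derivative_works by blast
  show "smooth_on S (\<lambda>p. frechet_derivative f (at p) v)"
    using assms unfolding smooth_on_def by (metis Ck_on.simps(2))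
  show "Ck_on k S f" using assms unfolding smooth_on_def by blast
qed

lemma smooth_on_cong:
  "open S \<Longrightarrow> smooth_on S f \<Longrightarrow> (\<And>q. q \<in> S \<Longrightarrow> f q = h q) \<Longrightarrow> smooth_on S h"
  unfolding smooth_on_def by (metis Ck_on_cong[of S _ f h])

lemma Ck_on_const: "Ck_on k S (\<lambda>_. c)"
  by (induction k arbitrary: c) (auto simp: frechet_derivative_const)

lemma smooth_on_const: "smooth_on S (\<lambda>_. c)"
  unfolding smooth_on_def by (simp add: Ck_on_const)

lemma smooth_on_linear:
  assumes "bounded_linear f" shows "smooth_on S f"
proof -
  have d: "(f has_derivative f) (at p)" for p
    using assms by (rule bounded_linear_imp_has_derivative)
  then have "frechet_derivative f (at p) = f" for p
    by (rule frechet_derivative_at[symmetric])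
  moreover have "f differentiable (at p)" for p using d by (auto intro: differentiableI)
  ultimately have "Ck_on (Suc k) S f" for k by (simp add: Ck_on_const)
  then show ?thesis unfolding smooth_on_def using Ck_on_SucD by blast
qed

lemma Ck_on_compose_linear:
  assumes "open S" "bounded_linear h" "Ck_on k S f"
  shows "Ck_on k S (\<lambda>p. h (f p))"
  using assms(3)
proof (induction k arbitrary: f)
  case 0
  then show ?case using bounded_linear.continuous_on[OF assms(2)] by simp
next
  case (Suc k)
  have d: "((\<lambda>p. h (f p)) has_derivative (\<lambda>v. h (frechet_derivative f (at p) v))) (at p)"
    if "p \<in> S" for p
    using Suc.prems that frechet_derivative_works[THEN iffD1]
    by (intro bounded_linear.has_derivative[OF assms(2)]) auto
  have "Ck_on k S (\<lambda>p. frechet_derivative (\<lambda>p. h (f p)) (at p) v)" for v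
  proof (rule Ck_on_cong[OF assms(1)])
    show "Ck_on k S (\<lambda>p. h (frechet_derivative f (at p) v))"
      by (rule Suc.IH) (use Suc.prems in simp)
  qed (simp add: frechet_derivative_at[OF d, symmetric])
  then show ?case using d by (auto intro: differentiableI)
qed

lemma Ck_on_add:
  assumes "open S" "Ck_on k S f" "Ck_on k S h"
  shows "Ck_on k S (\<lambda>p. f p + h p)"
  using assms(2,3)
proof (induction k arbitrary: f h)
  case 0
  then show ?case by (simp add: continuous_on_add)
next
  case (Suc k)
  have d: "((\<lambda>p. f p + h p) has_derivative
      (\<lambda>v. frechet_derivative f (at p) v + frechet_derivative h (at p) v)) (at p)"
    if "p \<in> S" for p
    using Suc.prems that by (intro has_derivative_add frechet_derivative_works[THEN iffD1]) auto
  have "Ck_on k S (\<lambda>p. frechet_derivative (\<lambda>p. f p + h p) (at p) v)" for v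
  proof (rule Ck_on_cong[OF assms(1)])
    show "Ck_on k S (\<lambda>p. frechet_derivative f (at p) v + frechet_derivative h (at p) v)"
      by (rule Suc.IH) (use Suc.prems in simp_all)
  qed (simp add: frechet_derivative_at[OF d, symmetric])
  then show ?case using d by (auto intro: differentiableI)
qed

lemma Ck_on_bilinear:
  assumes "open S" "bounded_bilinear B" "Ck_on k S f" "Ck_on k S h"
  shows "Ck_on k S (\<lambda>p. B (f p) (h p))"
  using assms(3,4)
proof (induction k arbitrary: f h)
  case 0
  then show ?case using bounded_bilinear.continuous_on[OF assms(2)] by simp
next
  case (Suc k)
  have d: "((\<lambda>p. B (f p) (h p)) has_derivative
      (\<lambda>v. B (f p) (frechet_derivative h (at p) v) + B (frechet_derivative f (at p) v) (h p))) (at p)"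
    if "p \<in> S" for p
    using Suc.prems that
    by (intro bounded_bilinear.FDERIV[OF assms(2)] frechet_derivative_works[THEN iffD1]) auto
  have "Ck_on k S (\<lambda>p. B (f p) (frechet_derivative h (at p) v)
      + B (frechet_derivative f (at p) v) (h p))" for v
    by (rule Ck_on_add[OF assms(1)]; rule Suc.IH)
      (use Suc.prems Ck_on_SucD[OF Suc.prems(1)] Ck_on_SucD[OF Suc.prems(2)] in simp_all)
  then have "Ck_on k S (\<lambda>p. frechet_derivative (\<lambda>p. B (f p) (h p)) (at p) v)" for v
    by (rule Ck_on_cong[OF assms(1)]) (auto simp: frechet_derivative_at[OF d, symmetric])
  then show ?case using d by (auto intro: differentiableI)
qed

lemma Ck_on_inverse:
  fixes f :: "'a::real_normed_vector \<Rightarrow> real"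
  assumes "open S" "Ck_on k S f" "\<And>p. p \<in> S \<Longrightarrow> f p \<noteq> 0"
  shows "Ck_on k S (\<lambda>p. inverse (f p))"
  using assms(2,3)
proof (induction k arbitrary: f)
  case 0
  then show ?case by (auto intro: continuous_on_inverse)
next
  case (Suc k)
  have d: "((\<lambda>p. inverse (f p)) has_derivative
      (\<lambda>v. - (inverse (f p) * frechet_derivative f (at p) v * inverse (f p)))) (at p)"
    if "p \<in> S" for p
    using Suc.prems that by (intro Deriv.has_derivative_inverse frechet_derivative_works[THEN iffD1]) auto
  have i: "Ck_on k S (\<lambda>p. inverse (f p))"
    using Suc.IH[OF Ck_on_SucD[OF Suc.prems(1)]] Suc.prems(2) by blast
  have "Ck_on k S (\<lambda>p. - (inverse (f p) * frechet_derivative f (at p) v * inverse (f p)))" for v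
    using Suc.prems(1)
    by (intro Ck_on_compose_linear[OF assms(1) bounded_linear_minus[OF bounded_linear_ident]]
        Ck_on_bilinear[OF assms(1) bounded_bilinear_mult] i) auto
  then have "Ck_on k S (\<lambda>p. frechet_derivative (\<lambda>p. inverse (f p)) (at p) v)" for v
    by (rule Ck_on_cong[OF assms(1)]) (auto simp: frechet_derivative_at[OF d, symmetric])
  then show ?case using d by (auto intro: differentiableI)
qed

lemma smooth_on_compose_linear:
  "open S \<Longrightarrow> bounded_linear h \<Longrightarrow> smooth_on S f \<Longrightarrow> smooth_on S (\<lambda>p. h (f p))"
  unfolding smooth_on_def by (metis Ck_on_compose_linear[of S h _ f])

lemma smooth_on_add:
  "open S \<Longrightarrow> smooth_on S f \<Longrightarrow> smooth_on S h \<Longrightarrow> smooth_on S (\<lambda>p. f p + h p)"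
  unfolding smooth_on_def by (metis Ck_on_add[of S _ f h])

lemma smooth_on_minus: "open S \<Longrightarrow> smooth_on S f \<Longrightarrow> smooth_on S (\<lambda>p. - f p)"
  using smooth_on_compose_linear[OF _ bounded_linear_minus[OF bounded_linear_ident], of S f] .

lemma smooth_on_diff:
  "open S \<Longrightarrow> smooth_on S f \<Longrightarrow> smooth_on S h \<Longrightarrow> smooth_on S (\<lambda>p. f p - h p)"
  using smooth_on_add[of S f "\<lambda>p. - h p"] smooth_on_minus[of S h] by simp

lemma smooth_on_scaleR:
  "open S \<Longrightarrow> smooth_on S f \<Longrightarrow> smooth_on S h \<Longrightarrow> smooth_on S (\<lambda>p. f p *\<^sub>R h p)"
  unfolding smooth_on_def by (metis Ck_on_bilinear[OF _ bounded_bilinear_scaleR, of S _ f h])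

lemma smooth_on_mult:
  fixes f h :: "'a::real_normed_vector \<Rightarrow> real"
  shows "open S \<Longrightarrow> smooth_on S f \<Longrightarrow> smooth_on S h \<Longrightarrow> smooth_on S (\<lambda>p. f p * h p)"
  unfolding smooth_on_def by (metis Ck_on_bilinear[OF _ bounded_bilinear_mult, of S _ f h])

lemma smooth_on_divide:
  fixes f h :: "'a::real_normed_vector \<Rightarrow> real"
  assumes "open S" "smooth_on S f" "smooth_on S h" "\<And>p. p \<in> S \<Longrightarrow> h p \<noteq> 0"
  shows "smooth_on S (\<lambda>p. f p / h p)"
proof -
  have "smooth_on S (\<lambda>p. inverse (h p))"
    using assms unfolding smooth_on_def by (metis Ck_on_inverse[of S _ h])
  then show ?thesis using smooth_on_mult[OF assms(1,2)] by (simp add: divide_inverse)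
qed

lemma smooth_on_power:
  fixes f :: "'a::real_normed_vector \<Rightarrow> real"
  shows "open S \<Longrightarrow> smooth_on S f \<Longrightarrow> smooth_on S (\<lambda>p. f p ^ n)"
proof (induction n)
  case (Suc n)
  then show ?case using smooth_on_mult[of S f "\<lambda>p. f p ^ n"] by simp
qed (simp add: smooth_on_const)

lemma smooth_on_sum:
  "open S \<Longrightarrow> finite I \<Longrightarrow> (\<And>i. i \<in> I \<Longrightarrow> smooth_on S (f i)) \<Longrightarrow> smooth_on S (\<lambda>p. \<Sum>i\<in>I. f i p)"
proof (induction "card I" arbitrary: I)
  case 0
  then show ?case by (simp add: smooth_on_const)
next
  case (Suc n)
  then obtain i J where I: "I = insert i J" "i \<notin> J" "card J = n" by (metis card_Suc_eq)
  then have "smooth_on S (f i)" "smooth_on S (\<lambda>p. \<Sum>i\<in>J. f i p)"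
    using Suc by simp_all
  then show ?case using smooth_on_add[OF Suc.prems(1)] I Suc.prems(2) by simp
qed

lemma smooth_on_fst: "open S \<Longrightarrow> smooth_on S f \<Longrightarrow> smooth_on S (\<lambda>p. fst (f p))"
  and smooth_on_snd: "open S \<Longrightarrow> smooth_on S f \<Longrightarrow> smooth_on S (\<lambda>p. snd (f p))"
  using smooth_on_compose_linear[OF _ bounded_linear_fst, of S f]
    smooth_on_compose_linear[OF _ bounded_linear_snd, of S f] by auto

lemma smooth_on_Pair:
  assumes "open S" "smooth_on S f" "smooth_on S h"
  shows "smooth_on S (\<lambda>p. (f p, h p))"
proof -
  have "smooth_on S (\<lambda>p. (f p, 0::'c))"
    by (rule smooth_on_compose_linear[OF assms(1) _ assms(2)])
      (intro bounded_linear_Pair bounded_linear_ident bounded_linear_zero)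
  moreover have "smooth_on S (\<lambda>p. (0::'b, h p))"
    by (rule smooth_on_compose_linear[OF assms(1) _ assms(3)])
      (intro bounded_linear_Pair bounded_linear_ident bounded_linear_zero)
  ultimately have "smooth_on S (\<lambda>p. (f p, 0::'c) + (0::'b, h p))"
    by (rule smooth_on_add[OF assms(1)])
  then show ?thesis by simp
qed

lemma smooth_on_vderiv:
  fixes X :: "'a::euclidean_space vfield"
  assumes "open S" "smooth_on S X" "smooth_on S f"
  shows "smooth_on S (vderiv X f)"
proof -
  have e: "vderiv X f p = (\<Sum>b\<in>Basis. (X p \<bullet> b) *\<^sub>R frechet_derivative f (at p) b)"
    if "p \<in> S" for p
  proof -
    interpret linear "frechet_derivative f (at p)"
      using smooth_onD(1)[OF assms(3) that] by (rule linear_frechet_derivative)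
    have "frechet_derivative f (at p) (X p)
        = frechet_derivative f (at p) (\<Sum>b\<in>Basis. (X p \<bullet> b) *\<^sub>R b)"
      by (simp add: euclidean_representation)
    then show ?thesis by (simp add: vderiv_def sum scale)
  qed
  have "smooth_on S (\<lambda>p. X p \<bullet> b)" for b
    by (rule smooth_on_compose_linear[OF assms(1) bounded_linear_inner_left assms(2)])
  then have "smooth_on S (\<lambda>p. \<Sum>b\<in>Basis. (X p \<bullet> b) *\<^sub>R frechet_derivative f (at p) b)"
    by (intro smooth_on_sum smooth_on_scaleR assms(1) finite_Basis smooth_onD(3)[OF assms(3)])
  then show ?thesis by (rule smooth_on_cong[OF assms(1)]) (simp add: e)
qed

text \<open>
  The following shows that the predicate \<open>levi_civita\<close> is satisfied by some connection on \<open>F4\<close>.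
  The coefficients are the Christoffel symbols of \<open>gF4\<close> in the coordinates \<open>(x, y, s, t)\<close>.
\<close>

definition GammaF4 :: "pt4 \<Rightarrow> pt4 \<Rightarrow> pt4 \<Rightarrow> pt4" where
  "GammaF4 = (\<lambda>(x, y, s, t) (a, b, c, d) (a', b', c', d').
    (- s / (2 * t^2) * (c*a' + a*c') + (s^2 / (2 * t^2) - 1/2) * (c*b' + b*c')
       - 1 / (2 * t) * (d*a' + a*d') + s / t * (d*b' + b*d'),
     - 1 / (2 * t^2) * (c*a' + a*c') + s / (2 * t^2) * (c*b' + b*c') + 1 / (2 * t) * (d*b' + b*d'),
     2 * t * (a*b' + b*a') - 4 * s * t * (b*b') - 1 / t * (c*d' + d*c'),
     2 * (a*a') - 2 * s * (a*b' + b*a') + 2 * (s^2 - t^2) * (b*b') + 1 / t * (c*c') - 1 / t * (d*d')))"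

definition nablaF4 :: "pt4 vfield \<Rightarrow> pt4 vfield \<Rightarrow> pt4 vfield" where
  "nablaF4 X Y p = vderiv X Y p + GammaF4 p (X p) (Y p)"

lemma gF4_eq:
  assumes "t > 0"
  shows "gF4 (x, y, s, t) (a, b, c, d) (a', b', c', d') =
    (a - s*b) * (a' - s*b') / t + t*b*b' + (c*c' + d*d') / (4*t^2)"
proof -
  have "(1 / sqrt t * a - s / sqrt t * b) * (1 / sqrt t * a' - s / sqrt t * b')
      = (a - s*b) * (a' - s*b') / (sqrt t * sqrt t)"
    by (simp add: diff_divide_distrib[symmetric])
  moreover have "(sqrt t * b) * (sqrt t * b') = (sqrt t * sqrt t) * b * b'" by simp
  ultimately show ?thesis using assms
    by (simp add: gF4_def theta1_def theta2_def theta3_def theta4_def field_simps power2_eq_square)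
qed

lemma smooth_on_GammaF4:
  assumes "smooth_on F4 X" "smooth_on F4 Y"
  shows "smooth_on F4 (\<lambda>p. GammaF4 p (X p) (Y p))"
proof -
  have "smooth_on F4 (\<lambda>p::pt4. p)"
    by (rule smooth_on_linear[OF bounded_linear_ident])
  with assms show ?thesis
    unfolding GammaF4_def case_prod_beta
    by (intro smooth_on_Pair smooth_on_add smooth_on_diff smooth_on_mult smooth_on_divide
        smooth_on_power smooth_on_minus smooth_on_const smooth_on_fst smooth_on_snd open_F4)
      (auto simp: F4_def)
qed

lemma nablaF4_metric:
  assumes "smooth_on F4 Y" "smooth_on F4 Z" "p \<in> F4"
  shows "vderiv X (\<lambda>q. gF4 q (Y q) (Z q)) p
       = gF4 p (nablaF4 X Y p) (Z p) + gF4 p (Y p) (nablaF4 X Z p)"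
proof -
  obtain x y s t where p: "p = (x, y, s, t)" and t: "t > 0"
    using assms(3) by (auto simp: F4_def)
  obtain a b c d where X: "X p = (a, b, c, d)" by (metis prod_cases4)
  obtain y1 y2 y3 y4 where Y: "Y p = (y1, y2, y3, y4)" by (metis prod_cases4)
  obtain z1 z2 z3 z4 where Z: "Z p = (z1, z2, z3, z4)" by (metis prod_cases4)
  define DY where "DY = frechet_derivative Y (at p)"
  define DZ where "DZ = frechet_derivative Z (at p)"
  have dY: "(Y has_derivative DY) (at p)" and dZ: "(Z has_derivative DZ) (at p)"
    using smooth_onD(2) assms by (auto simp: DY_def DZ_def)
  obtain u1 u2 u3 u4 where U: "DY (a, b, c, d) = (u1, u2, u3, u4)" by (metis prod_cases4)
  obtain v1 v2 v3 v4 where V: "DZ (a, b, c, d) = (v1, v2, v3, v4)" by (metis prod_cases4)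
  let ?s = "\<lambda>q::pt4. fst (snd (snd q))" and ?t = "\<lambda>q::pt4. snd (snd (snd q))"
  let ?h = "\<lambda>q. (fst (Y q) - ?s q * fst (snd (Y q))) * (fst (Z q) - ?s q * fst (snd (Z q))) / ?t q
      + ?t q * fst (snd (Y q)) * fst (snd (Z q))
      + (?s (Y q) * ?s (Z q) + ?t (Y q) * ?t (Z q)) / (4 * (?t q)^2)"
  have tp: "?t p \<noteq> 0" using t p by simp
  have eq: "?h q = gF4 q (Y q) (Z q)" if qF: "q \<in> F4" for q
  proof -
    obtain x y s t where q: "q = (x, y, s, t)" "t > 0"
      using qF by (auto simp: F4_def)
    show ?thesis
      using gF4_eq[OF q(2)] q(1) by (metis (no_types) fst_conv prod.collapse snd_conv)
  qed
  have "\<exists>h'. (?h has_derivative h') (at p) \<and> h' (a, b, c, d) =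
      gF4 p (nablaF4 X Y p) (Z p) + gF4 p (Y p) (nablaF4 X Z p)"
    apply (rule exI, rule conjI)
     apply (rule derivative_eq_intros dY dZ refl tp | simp add: tp)+
    using t
    apply (simp add: p nablaF4_def vderiv_def GammaF4_def gF4_eq
        X[unfolded p] Y[unfolded p] Z[unfolded p] DY_def[symmetric, unfolded p]
        DZ_def[symmetric, unfolded p] U[unfolded p] V[unfolded p])
    apply (simp add: field_simps power2_eq_square)
    done
  then obtain h' where h: "(?h has_derivative h') (at p)"
    "h' (a, b, c, d) = gF4 p (nablaF4 X Y p) (Z p) + gF4 p (Y p) (nablaF4 X Z p)" by blast
  have "((\<lambda>q. gF4 q (Y q) (Z q)) has_derivative h') (at p)"
    by (rule has_derivative_transform_within_open[OF h(1) open_F4 assms(3) eq])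
  then show ?thesis
    using h(2) X by (simp add: vderiv_def frechet_derivative_at[symmetric])
qed

lemma nablaF4_torsion:
  "nablaF4 X Y p - nablaF4 Y X p = lie_bracket X Y p"
proof -
  have "GammaF4 p u v = GammaF4 p v u" for u v
    by (cases p, cases u, cases v) (simp add: GammaF4_def algebra_simps)
  then show ?thesis by (simp add: nablaF4_def lie_bracket_def)
qed

lemma GammaF4_add:
  "GammaF4 p (u + u') v = GammaF4 p u v + GammaF4 p u' v"
  "GammaF4 p v (u + u') = GammaF4 p v u + GammaF4 p v u'"
  unfolding GammaF4_def case_prod_beta prod_eq_iff fst_add snd_add fst_conv snd_conv
  by (intro conjI; algebra)+

lemma GammaF4_scaleR:
  "GammaF4 p (r *\<^sub>R u) v = r *\<^sub>R GammaF4 p u v"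
  "GammaF4 p v (r *\<^sub>R u) = r *\<^sub>R GammaF4 p v u"
  unfolding GammaF4_def case_prod_beta prod_eq_iff fst_scaleR snd_scaleR fst_conv snd_conv
    real_scaleR_def
  by (intro conjI; algebra)+

lemma affine_connection_nablaF4: "affine_connection F4 nablaF4"
proof -
  have lin: "linear (frechet_derivative Y (at p))" if "smooth_on F4 Y" "p \<in> F4"
    for Y :: "pt4 vfield" and p
    using smooth_onD(1)[OF that] by (rule linear_frechet_derivative)
  have closed: "smooth_on F4 (nablaF4 X Y)" if "smooth_on F4 X" "smooth_on F4 Y" for X Y
    unfolding nablaF4_def[abs_def] using that
    by (intro smooth_on_add open_F4 smooth_on_vderiv smooth_on_GammaF4)
  have cong: "nablaF4 X Y p = nablaF4 X' Y' p"
    if "smooth_on F4 Y" "\<forall>p\<in>F4. X p = X' p \<and> Y p = Y' p" "p \<in> F4" for X X' Y Y' p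
  proof -
    have "frechet_derivative Y' (at p) = frechet_derivative Y (at p)"
      by (rule frechet_derivative_cong_open(2)[of F4 p Y Y'])
        (use that open_F4 smooth_onD(1)[OF that(1,3)] in blast)+
    then show ?thesis using that by (simp add: nablaF4_def vderiv_def)
  qed
  have add1: "nablaF4 (\<lambda>q. X q + X' q) Y p = nablaF4 X Y p + nablaF4 X' Y p"
    if "smooth_on F4 Y" "p \<in> F4" for X X' Y p
    using linear_add[OF lin[OF that]] by (simp add: nablaF4_def vderiv_def GammaF4_add)
  have scale1: "nablaF4 (\<lambda>q. f q *\<^sub>R X q) Y p = f p *\<^sub>R nablaF4 X Y p"
    if "smooth_on F4 Y" "p \<in> F4" for f X Y p
    using linear_scale[OF lin[OF that]]
    by (simp add: nablaF4_def vderiv_def GammaF4_scaleR scaleR_add_right)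
  have add2: "nablaF4 X (\<lambda>q. Y q + Y' q) p = nablaF4 X Y p + nablaF4 X Y' p"
    if "smooth_on F4 Y" "smooth_on F4 Y'" "p \<in> F4" for X Y Y' p
    using frechet_derivative_at[OF has_derivative_add[OF smooth_onD(2)[OF that(1,3)]
          smooth_onD(2)[OF that(2,3)]], symmetric]
    by (simp add: nablaF4_def vderiv_def GammaF4_add)
  have leibniz: "nablaF4 X (\<lambda>q. f q *\<^sub>R Y q) p = vderiv X f p *\<^sub>R Y p + f p *\<^sub>R nablaF4 X Y p"
    if "smooth_on F4 f" "smooth_on F4 Y" "p \<in> F4" for f X Y p
    using frechet_derivative_at[OF has_derivative_scaleR[OF smooth_onD(2)[OF that(1,3)]
          smooth_onD(2)[OF that(2,3)]], symmetric]
    by (simp add: nablaF4_def vderiv_def GammaF4_scaleR scaleR_add_right)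
  show ?thesis
    unfolding affine_connection_def
    by (intro conjI allI impI ballI; elim conjE;
        rule closed add1 scale1 add2 leibniz cong; assumption)
qed

lemma levi_civita_nablaF4: "levi_civita F4 gF4 nablaF4"
  unfolding levi_civita_def
  by (intro conjI allI impI ballI affine_connection_nablaF4 nablaF4_torsion; elim conjE;
      rule nablaF4_metric; assumption)

end

theory Submission
  imports Defs
begin

text \<open>
  The difference of two Levi-Civita connections is symmetric in its arguments and skew with respect
  to \<open>g\<close>, hence zero; so the given connection may be replaced by \<open>nablaF4\<close>. In the orthonormal
  frame one finds \<open>Ric = -6 (\<theta>\<^sub>3\<^sup>2 + \<theta>\<^sub>4\<^sup>2)\<close>. Writing
  \<open>\<xi> = A \<partial>\<^sub>x + B \<partial>\<^sub>y + S \<partial>\<^sub>s + T \<partial>\<^sub>t\<close>, the \<open>ss\<close>, \<open>st\<close> and \<open>tt\<close> components of the soliton equation form a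
  system for \<open>S\<close> and \<open>T\<close> along each hyperbolic plane. Its solutions would involve a term
  \<open>(\<mu> + 6) t ln t\<close>, which is compatible with all three equations only if \<open>\<mu> = -6\<close>; then \<open>S\<close> and \<open>T\<close>
  are explicit polynomials in \<open>s\<close> and \<open>t\<close>, with coefficients \<open>\<alpha>, \<beta>, \<gamma>\<close> depending on \<open>x\<close> and \<open>y\<close>. The mixed
  components determine \<open>A\<close> and \<open>B\<close> up to functions of \<open>x\<close> and \<open>y\<close> and relate the derivatives of the
  coefficients; the \<open>xx\<close> and \<open>yy\<close> components then force the coefficients to be constant.
\<close>

section \<open>Uniqueness of the Levi-Civita connection\<close>

lemma gF4_bilinear:
  "gF4 p (u + u') v = gF4 p u v + gF4 p u' v" "gF4 p u (v + v') = gF4 p u v + gF4 p u v'"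
  "gF4 p (u - u') v = gF4 p u v - gF4 p u' v" "gF4 p u (v - v') = gF4 p u v - gF4 p u v'"
  unfolding gF4_def theta1_def theta2_def theta3_def theta4_def case_prod_beta
    fst_add snd_add fst_diff snd_diff
  by algebra+

lemma gF4_sym: "gF4 p u v = gF4 p v u"
  by (simp add: gF4_def mult.commute)

lemma gF4_eq_0D:
  assumes "p \<in> F4" "gF4 p u u = 0"
  shows "u = 0"
proof -
  obtain x y s t where p: "p = (x, y, s, t)" and t: "t > 0" using assms(1) by (auto simp: F4_def)
  obtain a b c d where u: "u = (a, b, c, d)" by (metis prod_cases4)
  have "(a - s*b)\<^sup>2 / t + t*b\<^sup>2 + (c\<^sup>2 + d\<^sup>2) / (4*t\<^sup>2) = 0"
    using assms(2) t by (simp add: p u gF4_eq power2_eq_square algebra_simps)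
  moreover have "(a - s*b)\<^sup>2 / t \<ge> 0" "t*b\<^sup>2 \<ge> 0" "(c\<^sup>2 + d\<^sup>2) / (4*t\<^sup>2) \<ge> 0" using t by simp_all
  ultimately have "(a - s*b)\<^sup>2 / t = 0" "t*b\<^sup>2 = 0" "(c\<^sup>2 + d\<^sup>2) / (4*t\<^sup>2) = 0" by linarith+
  then have "a = 0" "b = 0" "c = 0" "d = 0" using t by (auto simp: sum_power2_eq_zero_iff)
  then show ?thesis by (simp only: u zero_prod_def)
qed

lemma levi_civita_smooth: "levi_civita S g D \<Longrightarrow> smooth_on S X \<Longrightarrow> smooth_on S Y \<Longrightarrow> smooth_on S (D X Y)"
  unfolding levi_civita_def affine_connection_def by (elim conjE) blast

lemma levi_civita_unique:
  assumes "levi_civita F4 gF4 D" "smooth_on F4 X" "smooth_on F4 Y" "p \<in> F4"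
  shows "D X Y p = nablaF4 X Y p"
proof -
  define K where "K X Y = D X Y p - nablaF4 X Y p" for X Y
  have sym: "K X Y = K Y X" if "smooth_on F4 X" "smooth_on F4 Y" for X Y
  proof -
    have "D X Y p - D Y X p = nablaF4 X Y p - nablaF4 Y X p"
      using assms(1,4) that unfolding levi_civita_def nablaF4_torsion by blast
    then show ?thesis unfolding K_def by (simp add: algebra_simps)
  qed
  have skew: "gF4 p (K X Y) (Z p) + gF4 p (Y p) (K X Z) = 0"
    if "smooth_on F4 X" "smooth_on F4 Y" "smooth_on F4 Z" for X Y Z
  proof -
    have "vderiv X (\<lambda>q. gF4 q (Y q) (Z q)) p = gF4 p (D X Y p) (Z p) + gF4 p (Y p) (D X Z p)"
      using assms(1,4) that unfolding levi_civita_def by blast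
    then show ?thesis
      using nablaF4_metric[OF that(2,3) assms(4), of X] unfolding K_def gF4_bilinear by simp
  qed
  define Z :: "pt4 vfield" where "Z = (\<lambda>_. K X Y)"
  have Z: "smooth_on F4 Z" unfolding Z_def by (rule smooth_on_const)
  have "gF4 p (K X Y) (Z p) = 0"
    using skew[OF assms(2,3) Z] skew[OF Z assms(2,3)] skew[OF assms(3) Z assms(2)]
      sym[OF assms(2,3)] sym[OF assms(2) Z] sym[OF assms(3) Z] gF4_sym
    by (metis (no_types, opaque_lifting) add.commute add_cancel_right_right add_eq_0_iff equal_neg_zero)
  then have "K X Y = 0" unfolding Z_def by (rule gF4_eq_0D[OF assms(4)])
  then show ?thesis by (simp add: K_def)
qed

lemma smooth_on_lie_bracket:
  fixes X Y :: "pt4 vfield"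
  assumes "smooth_on F4 X" "smooth_on F4 Y"
  shows "smooth_on F4 (lie_bracket X Y)"
  unfolding lie_bracket_def[abs_def]
  by (intro smooth_on_diff smooth_on_vderiv open_F4 assms)

lemma nablaF4_cong:
  assumes "smooth_on F4 Y" "\<And>q. q \<in> F4 \<Longrightarrow> Y q = Y' q" "p \<in> F4"
  shows "nablaF4 X Y p = nablaF4 X Y' p"
proof -
  have "frechet_derivative Y' (at p) = frechet_derivative Y (at p)"
    by (rule frechet_derivative_cong_open(2)[OF open_F4 assms(3)])
      (use assms smooth_onD(1)[OF assms(1,3)] in auto)
  then show ?thesis using assms by (simp add: nablaF4_def vderiv_def)
qed

lemma curvature_levi_civita:
  assumes LC: "levi_civita F4 gF4 D" and s: "smooth_on F4 X" "smooth_on F4 Y" "smooth_on F4 Z"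
    and p: "p \<in> F4"
  shows "curvature D X Y Z p = curvature nablaF4 X Y Z p"
proof -
  have *: "D U (D V Z) p = nablaF4 U (nablaF4 V Z) p" if "smooth_on F4 U" "smooth_on F4 V" for U V
  proof -
    have "D U (D V Z) p = nablaF4 U (D V Z) p"
      by (rule levi_civita_unique[OF LC that(1) levi_civita_smooth[OF LC that(2) s(3)] p])
    also have "\<dots> = nablaF4 U (nablaF4 V Z) p"
      by (rule nablaF4_cong[OF levi_civita_smooth[OF LC that(2) s(3)] levi_civita_unique[OF LC that(2) s(3)] p])
    finally show ?thesis .
  qed
  show ?thesis
    using * s levi_civita_unique[OF LC smooth_on_lie_bracket[OF s(1,2)] s(3) p]
    by (simp add: curvature_def)
qed

lemma lie_deriv_metric_eq:
  assumes "smooth_on F4 X" "smooth_on F4 Y" "p \<in> F4"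
  shows "lie_deriv_metric \<xi> gF4 X Y p = gF4 p (nablaF4 X \<xi> p) (Y p) + gF4 p (X p) (nablaF4 Y \<xi> p)"
  unfolding lie_deriv_metric_def nablaF4_metric[OF assms] nablaF4_torsion[symmetric] gF4_bilinear
  by simp

section \<open>Curvature of \<open>F\<^sup>4\<close>\<close>

text \<open>\<open>cov_ei p v\<close> is the covariant derivative of \<open>ei\<close> at \<open>p\<close> in the direction \<open>v\<close>.\<close>

definition cov_e1 :: "pt4 \<Rightarrow> pt4 \<Rightarrow> pt4" where "cov_e1 = (\<lambda>(x, y, s, t) (a, b, c, d).
  (- s * c * sqrt t / (2 * t\<^sup>2), - c * sqrt t / (2 * t\<^sup>2), 2 * t * sqrt t * b, 2 * sqrt t * (a - s * b)))"
definition cov_e2 :: "pt4 \<Rightarrow> pt4 \<Rightarrow> pt4" where "cov_e2 = (\<lambda>(x, y, s, t) (a, b, c, d).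
  (c / (2 * sqrt t), 0, 2 * sqrt t * (a - s * b), - 2 * t * sqrt t * b))"
definition cov_e3 :: "pt4 \<Rightarrow> pt4 \<Rightarrow> pt4" where "cov_e3 = (\<lambda>(x, y, s, t) (a, b, c, d).
  ((s\<^sup>2 / t - t) * b - s * a / t, (s * b - a) / t, 0, 2 * c))"
definition cov_e4 :: "pt4 \<Rightarrow> pt4 \<Rightarrow> pt4" where "cov_e4 = (\<lambda>(x, y, s, t) (a, b, c, d).
  (2 * s * b - a, b, - 2 * c, 0))"

lemma has_derivative_frame:
  assumes "t > 0"
  shows "(e1 has_derivative (\<lambda>(a, b, c, d). (d / (2 * sqrt t), 0, 0, 0))) (at (x, y, s, t))"
    "(e2 has_derivative (\<lambda>(a, b, c, d). (c / sqrt t - s * d / (2 * t * sqrt t), - d / (2 * t * sqrt t), 0, 0)))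
      (at (x, y, s, t))"
    "(e3 has_derivative (\<lambda>(a, b, c, d). (0, 0, 2 * d, 0))) (at (x, y, s, t))"
    "(e4 has_derivative (\<lambda>(a, b, c, d). (0, 0, 0, 2 * d))) (at (x, y, s, t))"
  unfolding e1_def e2_def e3_def e4_def case_prod_beta
  using assms
  by (auto intro!: derivative_eq_intros simp: fun_eq_iff field_simps power2_eq_square zero_prod_def)

lemma Ck_on_sqrt:
  fixes f :: "'a::real_normed_vector \<Rightarrow> real"
  assumes "open S" "Ck_on k S f" "\<And>p. p \<in> S \<Longrightarrow> f p > 0"
  shows "Ck_on k S (\<lambda>p. sqrt (f p))"
  using assms(2)
proof (induction k)
  case 0
  then show ?case by (auto intro: continuous_on_real_sqrt)
next
  case (Suc k)
  have d: "((\<lambda>p. sqrt (f p)) has_derivative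
      (\<lambda>v. frechet_derivative f (at p) v * inverse (2 * sqrt (f p)))) (at p)" if "p \<in> S" for p
  proof -
    have "(f has_derivative frechet_derivative f (at p)) (at p)"
      using Suc.prems that frechet_derivative_works by auto
    from has_derivative_real_sqrt[OF assms(3)[OF that] this] show ?thesis
      by (simp add: field_simps)
  qed
  have "Ck_on k S (\<lambda>p. 2 * sqrt (f p))"
    by (intro Ck_on_bilinear[OF assms(1) bounded_bilinear_mult] Ck_on_const
        Suc.IH Ck_on_SucD[OF Suc.prems])
  then have "Ck_on k S (\<lambda>p. inverse (2 * sqrt (f p)))"
    using assms(3) by (intro Ck_on_inverse[OF assms(1)]) force+
  then have "Ck_on k S (\<lambda>p. frechet_derivative f (at p) v * inverse (2 * sqrt (f p)))" for v
    using Suc.prems by (intro Ck_on_bilinear[OF assms(1) bounded_bilinear_mult]) auto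
  then have "Ck_on k S (\<lambda>p. frechet_derivative (\<lambda>p. sqrt (f p)) (at p) v)" for v
    by (rule Ck_on_cong[OF assms(1)]) (auto simp: frechet_derivative_at[OF d, symmetric])
  then show ?case using d by (auto intro: differentiableI)
qed

lemma smooth_on_sqrt:
  fixes f :: "'a::real_normed_vector \<Rightarrow> real"
  shows "open S \<Longrightarrow> smooth_on S f \<Longrightarrow> (\<And>p. p \<in> S \<Longrightarrow> f p > 0) \<Longrightarrow> smooth_on S (\<lambda>p. sqrt (f p))"
  unfolding smooth_on_def using Ck_on_sqrt by blast

lemma smooth_on_frame: "smooth_on F4 e1" "smooth_on F4 e2" "smooth_on F4 e3" "smooth_on F4 e4"
  unfolding e1_def e2_def e3_def e4_def case_prod_beta
  by (intro smooth_on_Pair smooth_on_mult smooth_on_divide smooth_on_sqrt smooth_on_const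
      smooth_on_fst smooth_on_snd smooth_on_linear[OF bounded_linear_ident] open_F4;
      force simp: F4_def)+

lemma frame_apply:
  "e1 (x, y, s, t) = (sqrt t, 0, 0, 0)" "e2 (x, y, s, t) = (s / sqrt t, 1 / sqrt t, 0, 0)"
  "e3 (x, y, s, t) = (0, 0, 2 * t, 0)" "e4 (x, y, s, t) = (0, 0, 0, 2 * t)"
  by (simp_all add: e1_def e2_def e3_def e4_def)

lemma nablaF4_frame:
  assumes "p \<in> F4"
  shows "nablaF4 X e1 p = cov_e1 p (X p)" "nablaF4 X e2 p = cov_e2 p (X p)"
    "nablaF4 X e3 p = cov_e3 p (X p)" "nablaF4 X e4 p = cov_e4 p (X p)"
proof -
  obtain x y s t where p: "p = (x, y, s, t)" and t: "t > 0" using assms(1) by (auto simp: F4_def)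
  obtain a b c d where X: "X (x, y, s, t) = (a, b, c, d)" by (metis prod_cases4)
  have r: "sqrt t * sqrt t = t" "sqrt t > 0" using t by auto
  note F = has_derivative_frame[OF t, THEN frechet_derivative_at, symmetric]
  show "nablaF4 X e1 p = cov_e1 p (X p)" "nablaF4 X e2 p = cov_e2 p (X p)"
    "nablaF4 X e3 p = cov_e3 p (X p)" "nablaF4 X e4 p = cov_e4 p (X p)"
    using t r(2)
    by (simp_all add: p nablaF4_def vderiv_def F X GammaF4_def frame_apply cov_e1_def cov_e2_def
      cov_e3_def cov_e4_def field_simps power2_eq_square)
      (simp_all add: mult.assoc[symmetric] r(1))
qed

lemma nablaF4_scaleR_e4:
  assumes "p \<in> F4"
  shows "nablaF4 X (\<lambda>q. k *\<^sub>R e4 q) p = k *\<^sub>R cov_e4 p (X p)"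
proof -
  have "vderiv X (\<lambda>q. k *\<^sub>R e4 q) p = k *\<^sub>R vderiv X e4 p"
    using frechet_derivative_at[OF has_derivative_scaleR_right[OF smooth_onD(2)[OF smooth_on_frame(4) assms]],
        symmetric]
    by (simp add: vderiv_def)
  then show ?thesis
    using nablaF4_frame(4)[OF assms, of X]
    by (simp add: nablaF4_def GammaF4_scaleR scaleR_add_right[symmetric])
qed

lemma smooth_on_nablaF4:
  "smooth_on F4 X \<Longrightarrow> smooth_on F4 Y \<Longrightarrow> smooth_on F4 (nablaF4 X Y)"
  using levi_civita_smooth[OF levi_civita_nablaF4] .

lemma curvature_nablaF4_eq:
  assumes X: "smooth_on F4 X" and E: "smooth_on F4 E" and p: "p \<in> F4"
    and M: "\<And>Y q. q \<in> F4 \<Longrightarrow> nablaF4 Y E q = M q (Y q)"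
    and k: "\<And>q. q \<in> F4 \<Longrightarrow> M q (E q) = k *\<^sub>R e4 q"
    and M': "((\<lambda>q. M q (X q)) has_derivative M') (at p)"
  shows "curvature nablaF4 X E E p = k *\<^sub>R cov_e4 p (X p)
    - (M' (E p) + GammaF4 p (E p) (M p (X p)))
    - M p (frechet_derivative E (at p) (X p) - frechet_derivative X (at p) (E p))"
proof -
  have "nablaF4 X (nablaF4 E E) p = k *\<^sub>R cov_e4 p (X p)"
    using nablaF4_cong[OF smooth_on_nablaF4[OF E E] _ p, of "\<lambda>q. k *\<^sub>R e4 q" X]
    by (simp add: M k nablaF4_scaleR_e4[OF p])
  moreover have "nablaF4 E (nablaF4 X E) p = M' (E p) + GammaF4 p (E p) (M p (X p))"
    using nablaF4_cong[OF smooth_on_nablaF4[OF X E] _ p, of "\<lambda>q. M q (X q)" E]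
    by (simp add: M) (simp add: nablaF4_def vderiv_def frechet_derivative_at[OF M', symmetric])
  ultimately show ?thesis
    by (simp add: curvature_def M p) (simp add: lie_bracket_def vderiv_def)
qed

lemma curvature_frame:
  assumes "smooth_on F4 X" "t > 0" "X (x, y, s, t) = (a, b, c, d)"
  shows "curvature nablaF4 X e1 e1 (x, y, s, t) = (2 * s * b, 2 * b, - c, - d)"
    and "curvature nablaF4 X e2 e2 (x, y, s, t) = (2 * (a - s * b), 0, - c, - d)"
    and "curvature nablaF4 X e3 e3 (x, y, s, t) = (- a, - b, 0, - 4 * d)"
    and "curvature nablaF4 X e4 e4 (x, y, s, t) = (- a, - b, - 4 * c, 0)"
proof -
  have p: "(x, y, s, t) \<in> F4" using assms(2) by (simp add: F4_def)
  note t = assms(2) and Xp = assms(3)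
  define DX where "DX = frechet_derivative X (at (x, y, s, t))"
  have dX: "(X has_derivative DX) (at (x, y, s, t))"
    unfolding DX_def by (rule smooth_onD(2)[OF assms(1) p])
  note F = has_derivative_frame[OF t, THEN frechet_derivative_at, symmetric]
  define r where "r = sqrt t"
  have r: "sqrt t = r" "t = r * r" "r > 0" using t unfolding r_def by auto
  note curv = curvature_nablaF4_eq[OF assms(1) _ p]
  have tp: "snd (snd (snd (x, y, s, t))) > 0" "snd (snd (snd (x, y, s, t))) \<noteq> 0"
    "sqrt (snd (snd (snd (x, y, s, t)))) \<noteq> 0" "t > 0" "t \<noteq> 0" using t by auto
  obtain u1 u2 u3 u4 where U: "DX (r, 0, 0, 0) = (u1, u2, u3, u4)" by (metis prod_cases4)
  have "\<exists>M'. ((\<lambda>q. cov_e1 q (X q)) has_derivative M') (at (x, y, s, t)) \<and>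
     M' (r, 0, 0, 0) = cov_e1 (x, y, s, t) (DX (r, 0, 0, 0))"
    unfolding cov_e1_def case_prod_beta
    apply (rule exI, rule conjI)
     apply (rule derivative_eq_intros dX refl tp | simp add: tp)+
    done
  then obtain M' where M': "((\<lambda>q. cov_e1 q (X q)) has_derivative M') (at (x, y, s, t))"
    "M' (r, 0, 0, 0) = cov_e1 (x, y, s, t) (DX (r, 0, 0, 0))" by blast
  have "cov_e1 q (e1 q) = 1 *\<^sub>R e4 q" if "q \<in> F4" for q
    using that by (auto simp: F4_def cov_e1_def frame_apply)
  from curv[OF smooth_on_frame(1) nablaF4_frame(1) this M'(1)]
  show "curvature nablaF4 X e1 e1 (x, y, s, t) = (2 * s * b, 2 * b, - c, - d)"
    using r(3)
    by (simp add: Xp frame_apply F DX_def[symmetric] r(1) M' U cov_e1_def cov_e4_def GammaF4_def)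
       (simp add: r(2) field_simps power2_eq_square)
  obtain v1 v2 v3 v4 where V: "DX (s / r, 1 / r, 0, 0) = (v1, v2, v3, v4)" by (metis prod_cases4)
  have "\<exists>M'. ((\<lambda>q. cov_e2 q (X q)) has_derivative M') (at (x, y, s, t)) \<and>
     M' (s / r, 1 / r, 0, 0) = cov_e2 (x, y, s, t) (DX (s / r, 1 / r, 0, 0))"
    unfolding cov_e2_def case_prod_beta
    apply (rule exI, rule conjI)
     apply (rule derivative_eq_intros dX refl tp | simp add: tp)+
    done
  then obtain M' where M': "((\<lambda>q. cov_e2 q (X q)) has_derivative M') (at (x, y, s, t))"
    "M' (s / r, 1 / r, 0, 0) = cov_e2 (x, y, s, t) (DX (s / r, 1 / r, 0, 0))" by blast
  have "cov_e2 q (e2 q) = (- 1) *\<^sub>R e4 q" if "q \<in> F4" for q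
    using that by (auto simp: F4_def cov_e2_def frame_apply)
  from curv[OF smooth_on_frame(2) nablaF4_frame(2) this M'(1)]
  show "curvature nablaF4 X e2 e2 (x, y, s, t) = (2 * (a - s * b), 0, - c, - d)"
    using r(3)
    by (simp add: Xp frame_apply F DX_def[symmetric] r(1) M' V cov_e2_def cov_e4_def GammaF4_def)
       (simp add: r(2) field_simps power2_eq_square)
  obtain w1 w2 w3 w4 where W: "DX (0, 0, 2 * t, 0) = (w1, w2, w3, w4)" by (metis prod_cases4)
  have "\<exists>M'. ((\<lambda>q. cov_e3 q (X q)) has_derivative M') (at (x, y, s, t)) \<and>
     M' (0, 0, 2 * t, 0) = cov_e3 (x, y, s, t) (DX (0, 0, 2 * t, 0)) + (4 * s * b - 2 * a, 2 * b, 0, 0)"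
    unfolding cov_e3_def case_prod_beta
    apply (rule exI, rule conjI)
     apply (rule derivative_eq_intros dX refl tp | simp add: tp)+
    using t apply (simp add: Xp field_simps power2_eq_square)
    done
  then obtain M' where M': "((\<lambda>q. cov_e3 q (X q)) has_derivative M') (at (x, y, s, t))"
    "M' (0, 0, 2 * t, 0) = cov_e3 (x, y, s, t) (DX (0, 0, 2 * t, 0)) + (4 * s * b - 2 * a, 2 * b, 0, 0)"
    by blast
  have "cov_e3 q (e3 q) = 2 *\<^sub>R e4 q" if "q \<in> F4" for q
    using that by (auto simp: F4_def cov_e3_def frame_apply)
  from curv[OF smooth_on_frame(3) nablaF4_frame(3) this M'(1)]
  show "curvature nablaF4 X e3 e3 (x, y, s, t) = (- a, - b, 0, - 4 * d)"
    using t
    by (simp add: Xp frame_apply F DX_def[symmetric] M' W cov_e3_def cov_e4_def GammaF4_def)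
       (simp add: field_simps power2_eq_square)
  obtain z1 z2 z3 z4 where Z: "DX (0, 0, 0, 2 * t) = (z1, z2, z3, z4)" by (metis prod_cases4)
  have "\<exists>M'. ((\<lambda>q. cov_e4 q (X q)) has_derivative M') (at (x, y, s, t)) \<and>
     M' (0, 0, 0, 2 * t) = cov_e4 (x, y, s, t) (DX (0, 0, 0, 2 * t))"
    unfolding cov_e4_def case_prod_beta
    apply (rule exI, rule conjI)
     apply (rule derivative_eq_intros dX refl tp | simp add: tp)+
    done
  then obtain M' where M': "((\<lambda>q. cov_e4 q (X q)) has_derivative M') (at (x, y, s, t))"
    "M' (0, 0, 0, 2 * t) = cov_e4 (x, y, s, t) (DX (0, 0, 0, 2 * t))" by blast
  have "cov_e4 q (e4 q) = 0 *\<^sub>R e4 q" if "q \<in> F4" for q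
    using that by (auto simp: F4_def cov_e4_def frame_apply zero_prod_def)
  from curv[OF smooth_on_frame(4) nablaF4_frame(4) this M'(1)]
  show "curvature nablaF4 X e4 e4 (x, y, s, t) = (- a, - b, - 4 * c, 0)"
    using t
    by (simp add: Xp frame_apply F DX_def[symmetric] M' Z cov_e4_def GammaF4_def)
qed

lemma ricci_eq:
  assumes "levi_civita F4 gF4 D" "smooth_on F4 X" "t > 0" "X (x, y, s, t) = (a, b, c, d)"
  shows "ricci gF4 D frameF4 X Y (x, y, s, t)
    = gF4 (x, y, s, t) (0, 0, - 6 * c, - 6 * d) (Y (x, y, s, t))"
proof -
  have p: "(x, y, s, t) \<in> F4" using assms(3) by (simp add: F4_def)
  show ?thesis
    unfolding ricci_def
    by (simp add: curvature_levi_civita[OF assms(1,2) _ _ p] smooth_on_frame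
        curvature_frame[OF assms(2-4)] gF4_bilinear(1)[symmetric])
qed

section \<open>The soliton equation in coordinates\<close>

definition soliton_form :: "pt4 vfield \<Rightarrow> real \<Rightarrow> pt4 \<Rightarrow> pt4 \<Rightarrow> pt4 \<Rightarrow> real" where
  "soliton_form \<xi> \<mu> p u v =
     gF4 p (0, 0, - 6 * fst (snd (snd u)), - 6 * snd (snd (snd u))) v
     + 1/2 * (gF4 p (frechet_derivative \<xi> (at p) u + GammaF4 p u (\<xi> p)) v
            + gF4 p u (frechet_derivative \<xi> (at p) v + GammaF4 p v (\<xi> p)))
     - \<mu> * gF4 p u v"

lemma ricci_soliton_iff:
  assumes LC: "levi_civita F4 gF4 D" and \<xi>: "smooth_on F4 \<xi>"
  shows "ricci_soliton F4 gF4 D frameF4 \<xi> \<mu> \<longleftrightarrow> (\<forall>p\<in>F4. \<forall>u v. soliton_form \<xi> \<mu> p u v = 0)"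
proof -
  have *: "ricci gF4 D frameF4 X Y p + 1/2 * lie_deriv_metric \<xi> gF4 X Y p - \<mu> * gF4 p (X p) (Y p)
      = soliton_form \<xi> \<mu> p (X p) (Y p)"
    if sXY: "smooth_on F4 X" "smooth_on F4 Y" and pF: "p \<in> F4" for X Y p
  proof -
    obtain x y s t where p: "p = (x, y, s, t)" "t > 0" using pF by (auto simp: F4_def)
    obtain a b c d where X: "X p = (a, b, c, d)" by (metis prod_cases4)
    show ?thesis
      using ricci_eq[OF LC sXY(1) p(2) X[unfolded p(1)], of Y] X p(1)
      unfolding lie_deriv_metric_eq[OF sXY pF]
      by (simp add: soliton_form_def nablaF4_def vderiv_def)
  qed
  show ?thesis
  proof
    assume sol: "ricci_soliton F4 gF4 D frameF4 \<xi> \<mu>"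
    show "\<forall>p\<in>F4. \<forall>u v. soliton_form \<xi> \<mu> p u v = 0"
    proof (intro ballI allI)
      fix p u v assume p: "p \<in> F4"
      show "soliton_form \<xi> \<mu> p u v = 0"
        using sol p *[OF smooth_on_const smooth_on_const p, of u v]
        unfolding ricci_soliton_def by (simp add: smooth_on_const)
    qed
  next
    assume "\<forall>p\<in>F4. \<forall>u v. soliton_form \<xi> \<mu> p u v = 0"
    then show "ricci_soliton F4 gF4 D frameF4 \<xi> \<mu>"
      unfolding ricci_soliton_def using \<xi> * by (metis eq_iff_diff_eq_0)
  qed
qed

lemma partial_derivatives:
  assumes "(\<xi> has_derivative D) (at (x, y, s, t))" "bounded_linear (L :: pt4 \<Rightarrow> real)"
  shows "((\<lambda>x. L (\<xi> (x, y, s, t))) has_real_derivative L (D (1, 0, 0, 0))) (at x)"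
    "((\<lambda>y. L (\<xi> (x, y, s, t))) has_real_derivative L (D (0, 1, 0, 0))) (at y)"
    "((\<lambda>s. L (\<xi> (x, y, s, t))) has_real_derivative L (D (0, 0, 1, 0))) (at s)"
    "((\<lambda>t. L (\<xi> (x, y, s, t))) has_real_derivative L (D (0, 0, 0, 1))) (at t)"
proof -
  interpret D: bounded_linear D using assms(1) by (rule has_derivative_bounded_linear)
  interpret L: bounded_linear L by (rule assms(2))
  have *: "((\<lambda>r. L (\<xi> (c r))) has_real_derivative L (D v)) (at r)"
    if "c r = (x, y, s, t)" "(c has_derivative (\<lambda>h. h *\<^sub>R v)) (at r)" for c v and r :: real
    using L.has_derivative[OF has_derivative_compose[OF that(2), of \<xi> D]] assms(1) that(1)
    by (simp add: has_field_derivative_def D.scaleR L.scaleR mult.commute[of "L (D v)"] o_def fun_eq_iff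
        mult_commute_abs)
  show "((\<lambda>x. L (\<xi> (x, y, s, t))) has_real_derivative L (D (1, 0, 0, 0))) (at x)"
    "((\<lambda>y. L (\<xi> (x, y, s, t))) has_real_derivative L (D (0, 1, 0, 0))) (at y)"
    "((\<lambda>s. L (\<xi> (x, y, s, t))) has_real_derivative L (D (0, 0, 1, 0))) (at s)"
    "((\<lambda>t. L (\<xi> (x, y, s, t))) has_real_derivative L (D (0, 0, 0, 1))) (at t)"
    by (rule *; auto intro!: derivative_eq_intros simp: zero_prod_def)+
qed

lemma soliton_form_basis:
  assumes "t > 0" "\<xi> (x, y, s, t) = (A, B, S, T)"
    and "frechet_derivative \<xi> (at (x, y, s, t)) (1, 0, 0, 0) = (Ax, Bx, Sx, Tx)"
    and "frechet_derivative \<xi> (at (x, y, s, t)) (0, 1, 0, 0) = (Ay, By, Sy, Ty)"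
    and "frechet_derivative \<xi> (at (x, y, s, t)) (0, 0, 1, 0) = (As, Bs, Ss, Ts)"
    and "frechet_derivative \<xi> (at (x, y, s, t)) (0, 0, 0, 1) = (At, Bt, St, Tt)"
  shows "soliton_form \<xi> \<mu> (x, y, s, t) (1, 0, 0, 0) (1, 0, 0, 0)
      = (2 * t * (Ax - s * Bx) - T - 2 * \<mu> * t) / (2 * t\<^sup>2)"
    and "soliton_form \<xi> \<mu> (x, y, s, t) (1, 0, 0, 0) (0, 1, 0, 0)
      = (s * T - t * S + t * (Ay - s * By) + t * ((s\<^sup>2 + t\<^sup>2) * Bx - s * Ax) + 2 * \<mu> * s * t) / (2 * t\<^sup>2)"
    and "soliton_form \<xi> \<mu> (x, y, s, t) (0, 1, 0, 0) (0, 1, 0, 0)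
      = (2 * s * t * S + (t\<^sup>2 - s\<^sup>2) * T + 2 * t * ((s\<^sup>2 + t\<^sup>2) * By - s * Ay)
        - 2 * \<mu> * t * (s\<^sup>2 + t\<^sup>2)) / (2 * t\<^sup>2)"
    and "soliton_form \<xi> \<mu> (x, y, s, t) (1, 0, 0, 0) (0, 0, 1, 0)
      = (4 * t * (As - s * Bs) + Sx) / (8 * t\<^sup>2)"
    and "soliton_form \<xi> \<mu> (x, y, s, t) (1, 0, 0, 0) (0, 0, 0, 1)
      = (4 * t * (At - s * Bt) + Tx) / (8 * t\<^sup>2)"
    and "soliton_form \<xi> \<mu> (x, y, s, t) (0, 1, 0, 0) (0, 0, 1, 0)
      = (4 * t * ((s\<^sup>2 + t\<^sup>2) * Bs - s * As) + Sy) / (8 * t\<^sup>2)"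
    and "soliton_form \<xi> \<mu> (x, y, s, t) (0, 1, 0, 0) (0, 0, 0, 1)
      = (4 * t * ((s\<^sup>2 + t\<^sup>2) * Bt - s * At) + Ty) / (8 * t\<^sup>2)"
    and "soliton_form \<xi> \<mu> (x, y, s, t) (0, 0, 1, 0) (0, 0, 1, 0)
      = (t * Ss - T - (\<mu> + 6) * t) / (4 * t^3)"
    and "soliton_form \<xi> \<mu> (x, y, s, t) (0, 0, 1, 0) (0, 0, 0, 1) = (St + Ts) / (8 * t\<^sup>2)"
    and "soliton_form \<xi> \<mu> (x, y, s, t) (0, 0, 0, 1) (0, 0, 0, 1)
      = (t * Tt - T - (\<mu> + 6) * t) / (4 * t^3)"
  unfolding soliton_form_def assms(2-6) using assms(1)
  by (simp_all add: gF4_eq GammaF4_def)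
    (simp_all add: field_simps power2_eq_square power3_eq_cube)

section \<open>Solution of the soliton equations\<close>

lemma same_derivative_pos:
  fixes f h :: "real \<Rightarrow> real"
  assumes "\<And>t. t > 0 \<Longrightarrow> (f has_real_derivative d t) (at t)"
    and "\<And>t. t > 0 \<Longrightarrow> (h has_real_derivative d t) (at t)" and "t > 0"
  shows "f t - f 1 = h t - h 1"
proof -
  have "((\<lambda>t. f t - h t) has_real_derivative 0) (at t within {0<..})" if "t \<in> {0<..}" for t
    using DERIV_diff[OF assms(1,2)] that has_field_derivative_at_within by fastforce
  from has_field_derivative_zero_constant[OF _ this]
  obtain c where "\<And>t. t \<in> {0<..} \<Longrightarrow> f t - h t = c" by auto
  from this[of t] this[of 1] assms(3) show ?thesis by simp
qed

lemma same_derivative: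
  fixes f h :: "real \<Rightarrow> real"
  assumes "\<And>t. (f has_real_derivative d t) (at t)"
    and "\<And>t. (h has_real_derivative d t) (at t)"
  shows "f t - f 0 = h t - h 0"
proof -
  have "((\<lambda>t. f t - h t) has_real_derivative 0) (at t)" for t
    using DERIV_diff[OF assms] by simp
  then have "f t - h t = f 0 - h 0" using DERIV_isconst_all by blast
  then show ?thesis by simp
qed

lemma affine_of_const_deriv:
  fixes f :: "real \<Rightarrow> real"
  assumes "\<And>x. (f has_real_derivative c) (at x)"
  shows "f x = f 0 + c * x"
proof -
  have "f x - f 0 = c * x - c * 0"
    by (rule same_derivative[OF assms]) (auto intro!: derivative_eq_intros)
  then show ?thesis by simp
qed

locale soliton_pde =
  fixes A B S T :: "real \<Rightarrow> real \<Rightarrow> real \<Rightarrow> real \<Rightarrow> real"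
    and Ax Ay As At Bx By Bs Bt Sx Sy Ss St Tx Ty Ts Tt ::
      "real \<Rightarrow> real \<Rightarrow> real \<Rightarrow> real \<Rightarrow> real"
    and \<mu> :: real
  assumes dx: "t > 0 \<Longrightarrow> ((\<lambda>x. A x y s t) has_real_derivative Ax x y s t) (at x)"
      "t > 0 \<Longrightarrow> ((\<lambda>x. B x y s t) has_real_derivative Bx x y s t) (at x)"
      "t > 0 \<Longrightarrow> ((\<lambda>x. S x y s t) has_real_derivative Sx x y s t) (at x)"
      "t > 0 \<Longrightarrow> ((\<lambda>x. T x y s t) has_real_derivative Tx x y s t) (at x)"
    and dy: "t > 0 \<Longrightarrow> ((\<lambda>y. A x y s t) has_real_derivative Ay x y s t) (at y)"
      "t > 0 \<Longrightarrow> ((\<lambda>y. B x y s t) has_real_derivative By x y s t) (at y)"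
      "t > 0 \<Longrightarrow> ((\<lambda>y. S x y s t) has_real_derivative Sy x y s t) (at y)"
      "t > 0 \<Longrightarrow> ((\<lambda>y. T x y s t) has_real_derivative Ty x y s t) (at y)"
    and ds: "t > 0 \<Longrightarrow> ((\<lambda>s. A x y s t) has_real_derivative As x y s t) (at s)"
      "t > 0 \<Longrightarrow> ((\<lambda>s. B x y s t) has_real_derivative Bs x y s t) (at s)"
      "t > 0 \<Longrightarrow> ((\<lambda>s. S x y s t) has_real_derivative Ss x y s t) (at s)"
      "t > 0 \<Longrightarrow> ((\<lambda>s. T x y s t) has_real_derivative Ts x y s t) (at s)"
    and dt: "t > 0 \<Longrightarrow> ((\<lambda>t. A x y s t) has_real_derivative At x y s t) (at t)"
      "t > 0 \<Longrightarrow> ((\<lambda>t. B x y s t) has_real_derivative Bt x y s t) (at t)"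
      "t > 0 \<Longrightarrow> ((\<lambda>t. S x y s t) has_real_derivative St x y s t) (at t)"
      "t > 0 \<Longrightarrow> ((\<lambda>t. T x y s t) has_real_derivative Tt x y s t) (at t)"
    and xx: "t > 0 \<Longrightarrow> 2 * t * (Ax x y s t - s * Bx x y s t) - T x y s t = 2 * \<mu> * t"
    and yy: "t > 0 \<Longrightarrow> 2 * s * t * S x y s t + (t\<^sup>2 - s\<^sup>2) * T x y s t
        + 2 * t * ((s\<^sup>2 + t\<^sup>2) * By x y s t - s * Ay x y s t) = 2 * \<mu> * t * (s\<^sup>2 + t\<^sup>2)"
    and xs: "t > 0 \<Longrightarrow> 4 * t * (As x y s t - s * Bs x y s t) + Sx x y s t = 0"
    and xt: "t > 0 \<Longrightarrow> 4 * t * (At x y s t - s * Bt x y s t) + Tx x y s t = 0"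
    and ys: "t > 0 \<Longrightarrow> 4 * t * ((s\<^sup>2 + t\<^sup>2) * Bs x y s t - s * As x y s t) + Sy x y s t = 0"
    and yt: "t > 0 \<Longrightarrow> 4 * t * ((s\<^sup>2 + t\<^sup>2) * Bt x y s t - s * At x y s t) + Ty x y s t = 0"
    and ss: "t > 0 \<Longrightarrow> t * Ss x y s t - T x y s t = (\<mu> + 6) * t"
    and st: "t > 0 \<Longrightarrow> St x y s t + Ts x y s t = 0"
    and tt: "t > 0 \<Longrightarrow> t * Tt x y s t - T x y s t = (\<mu> + 6) * t"
begin

lemma T_eq_log:
  assumes "t > 0"
  shows "T x y s t = t * ((\<mu> + 6) * ln t + T x y s 1)"
proof -
  have "T x y s t / t - T x y s 1 / 1 = (\<mu> + 6) * ln t - (\<mu> + 6) * ln 1"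
  proof (rule same_derivative_pos[OF _ _ assms])
    fix t :: real assume t: "t > 0"
    show "((\<lambda>t. T x y s t / t) has_real_derivative (\<mu> + 6) / t) (at t)"
      using t tt[OF t, of x y s]
      by (auto intro!: derivative_eq_intros dt(4)[OF t] simp: field_simps)
    show "((\<lambda>t. (\<mu> + 6) * ln t) has_real_derivative (\<mu> + 6) / t) (at t)"
      using t by (auto intro!: derivative_eq_intros)
  qed
  then show ?thesis using assms by (simp add: field_simps)
qed

lemma Ts_eq:
  assumes "t > 0"
  shows "Ts x y s t = t * Ts x y s 1"
proof (rule DERIV_unique)
  show "((\<lambda>s. T x y s t) has_real_derivative Ts x y s t) (at s)" by (rule ds(4)[OF assms])
  have "((\<lambda>s. t * ((\<mu> + 6) * ln t + T x y s 1)) has_real_derivative t * Ts x y s 1) (at s)"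
    by (auto intro!: derivative_eq_intros ds(4))
  then show "((\<lambda>s. T x y s t) has_real_derivative t * Ts x y s 1) (at s)"
    by (simp add: T_eq_log[OF assms, symmetric])
qed

lemma S_eq_Ts:
  assumes "t > 0"
  shows "S x y s t - S x y s 1 = (1 - t\<^sup>2) / 2 * Ts x y s 1"
proof -
  have "S x y s t - S x y s 1 = - (t\<^sup>2 / 2 * Ts x y s 1) - - (1\<^sup>2 / 2 * Ts x y s 1)"
  proof (rule same_derivative_pos[OF _ _ assms])
    fix t :: real assume t: "t > 0"
    show "((\<lambda>t. S x y s t) has_real_derivative - t * Ts x y s 1) (at t)"
      using dt(3)[OF t, of x y s] st[OF t, of x y s] Ts_eq[OF t, of x y s]
      by (simp add: add_eq_0_iff)
    show "((\<lambda>t. - (t\<^sup>2 / 2 * Ts x y s 1)) has_real_derivative - t * Ts x y s 1) (at t)"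
      by (auto intro!: derivative_eq_intros)
  qed
  then show ?thesis by (simp add: field_simps)
qed

text \<open>
  \<open>S\<close> is known to be differentiable, and \<open>S_eq_Ts\<close> passes this on to \<open>Ts\<close>. The derivative cannot depend on
  the auxiliary \<open>t\<close>, whence \<open>mu_eq\<close>.
\<close>

lemma deriv_Ts:
  assumes "t > 1"
  shows "((\<lambda>s. Ts x y s 1) has_real_derivative - 2 * (\<mu> + 6) * ln t / (t\<^sup>2 - 1)) (at s)"
proof -
  have t: "t > 0" "t\<^sup>2 - 1 > 0" using assms by (simp_all add: one_less_power)
  have "t * Ss x y s t = t * ((\<mu> + 6) * ln t + T x y s 1 + (\<mu> + 6))"
    using ss[OF t(1), of x y s] T_eq_log[OF t(1), of x y s] by (simp add: algebra_simps)
  then have "Ss x y s t = (\<mu> + 6) * ln t + T x y s 1 + (\<mu> + 6)" using t by simp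
  then have "Ss x y s 1 - Ss x y s t = - (\<mu> + 6) * ln t"
    using ss[of 1 x y s] t by (simp add: algebra_simps)
  moreover have "((\<lambda>s. 2 / (t\<^sup>2 - 1) * (S x y s 1 - S x y s t)) has_real_derivative
      2 / (t\<^sup>2 - 1) * (Ss x y s 1 - Ss x y s t)) (at s)"
    by (intro DERIV_cmult DERIV_diff ds t zero_less_one)
  moreover have "2 / (t\<^sup>2 - 1) * (S x y s 1 - S x y s t) = Ts x y s 1" for s
    using S_eq_Ts[OF t(1), of x y s] t by (simp add: field_simps)
  moreover have "2 / (t\<^sup>2 - 1) * (- (\<mu> + 6) * ln t) = - 2 * (\<mu> + 6) * ln t / (t\<^sup>2 - 1)" by simp
  ultimately show ?thesis by (simp only:)
qed

lemma mu_eq: "\<mu> = -6"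
proof -
  have "- 2 * (\<mu> + 6) * ln 2 / (2\<^sup>2 - 1) = - 2 * (\<mu> + 6) * ln 4 / (4\<^sup>2 - 1)"
    by (rule DERIV_unique[OF deriv_Ts deriv_Ts]) auto
  moreover have "ln (4::real) = 2 * ln 2" using ln_realpow[of "2::real" 2] by simp
  ultimately have "(\<mu> + 6) * ln 2 = 0" by simp
  then show ?thesis by simp
qed

definition \<alpha> :: "real \<Rightarrow> real \<Rightarrow> real" where "\<alpha> x y = T x y 0 1"
definition \<beta> :: "real \<Rightarrow> real \<Rightarrow> real" where "\<beta> x y = T x y 1 1 - T x y 0 1"
definition \<gamma> :: "real \<Rightarrow> real \<Rightarrow> real" where "\<gamma> x y = S x y 0 1 + \<beta> x y / 2"

lemma T_eq:
  assumes "t > 0"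
  shows "T x y s t = t * (\<alpha> x y + \<beta> x y * s)"
proof -
  have const: "Ts x y s 1 = Ts x y 0 1" for s
    using deriv_Ts[of 2 x y] mu_eq by (intro DERIV_isconst_all) simp
  have lin: "T x y s 1 - T x y 0 1 = Ts x y 0 1 * s - Ts x y 0 1 * 0" for s
  proof (rule same_derivative)
    show "((\<lambda>s. T x y s 1) has_real_derivative Ts x y 0 1) (at s)" for s
      using ds(4)[of 1 x y s] const[of s] by simp
  qed (auto intro!: derivative_eq_intros)
  have "T x y s 1 = \<alpha> x y + \<beta> x y * s"
    using lin[of s] lin[of 1] unfolding \<alpha>_def \<beta>_def by simp
  then show ?thesis using T_eq_log[OF assms, of x y s] mu_eq by simp
qed

lemma Ts_eq_\<beta>: "Ts x y s 1 = \<beta> x y"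
proof (rule DERIV_unique)
  show "((\<lambda>s. T x y s 1) has_real_derivative Ts x y s 1) (at s)" by (rule ds(4)) simp
  show "((\<lambda>s. T x y s 1) has_real_derivative \<beta> x y) (at s)"
    by (auto intro!: derivative_eq_intros simp: T_eq)
qed

lemma S_eq:
  assumes "t > 0"
  shows "S x y s t = \<alpha> x y * s + \<beta> x y * (s\<^sup>2 - t\<^sup>2) / 2 + \<gamma> x y"
proof -
  have "S x y s 1 - S x y 0 1 = (\<alpha> x y * s + \<beta> x y * s\<^sup>2 / 2) - (\<alpha> x y * 0 + \<beta> x y * 0\<^sup>2 / 2)"
  proof (rule same_derivative)
    show "((\<lambda>s. S x y s 1) has_real_derivative \<alpha> x y + \<beta> x y * s) (at s)" for s
      using ds(3)[of 1 x y s] ss[of 1 x y s] by (simp add: mu_eq T_eq)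
  qed (auto intro!: derivative_eq_intros)
  then show ?thesis
    using S_eq_Ts[OF assms, of x y s] unfolding Ts_eq_\<beta> \<gamma>_def
    by (simp add: field_simps)
qed

definition \<alpha>x where "\<alpha>x x y = Tx x y 0 1"
definition \<alpha>y where "\<alpha>y x y = Ty x y 0 1"
definition \<beta>x where "\<beta>x x y = Tx x y 1 1 - Tx x y 0 1"
definition \<beta>y where "\<beta>y x y = Ty x y 1 1 - Ty x y 0 1"
definition \<gamma>x where "\<gamma>x x y = Sx x y 0 1 + \<beta>x x y / 2"
definition \<gamma>y where "\<gamma>y x y = Sy x y 0 1 + \<beta>y x y / 2"

lemma deriv_coeffs:
  "((\<lambda>x. \<alpha> x y) has_real_derivative \<alpha>x x y) (at x)"
  "((\<lambda>y. \<alpha> x y) has_real_derivative \<alpha>y x y) (at y)"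
  "((\<lambda>x. \<beta> x y) has_real_derivative \<beta>x x y) (at x)"
  "((\<lambda>y. \<beta> x y) has_real_derivative \<beta>y x y) (at y)"
  "((\<lambda>x. \<gamma> x y) has_real_derivative \<gamma>x x y) (at x)"
  "((\<lambda>y. \<gamma> x y) has_real_derivative \<gamma>y x y) (at y)"
  unfolding \<alpha>_def \<beta>_def \<gamma>_def \<alpha>x_def \<alpha>y_def \<beta>x_def \<beta>y_def \<gamma>x_def \<gamma>y_def
  by (auto intro!: derivative_eq_intros dx dy)

lemma deriv_ST:
  assumes "t > 0"
  shows "Tx x y s t = t * (\<alpha>x x y + \<beta>x x y * s)" "Ty x y s t = t * (\<alpha>y x y + \<beta>y x y * s)"
    "Sx x y s t = \<alpha>x x y * s + \<beta>x x y * (s\<^sup>2 - t\<^sup>2) / 2 + \<gamma>x x y"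
    "Sy x y s t = \<alpha>y x y * s + \<beta>y x y * (s\<^sup>2 - t\<^sup>2) / 2 + \<gamma>y x y"
proof -
  show "Tx x y s t = t * (\<alpha>x x y + \<beta>x x y * s)"
    by (rule DERIV_unique[OF dx(4)[OF assms, of y s x]])
      (auto intro!: derivative_eq_intros deriv_coeffs simp: T_eq assms)
  show "Ty x y s t = t * (\<alpha>y x y + \<beta>y x y * s)"
    by (rule DERIV_unique[OF dy(4)[OF assms, of x s y]])
      (auto intro!: derivative_eq_intros deriv_coeffs simp: T_eq assms)
  show "Sx x y s t = \<alpha>x x y * s + \<beta>x x y * (s\<^sup>2 - t\<^sup>2) / 2 + \<gamma>x x y"
    by (rule DERIV_unique[OF dx(3)[OF assms, of y s x]])
      (auto intro!: derivative_eq_intros deriv_coeffs simp: S_eq assms)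
  show "Sy x y s t = \<alpha>y x y * s + \<beta>y x y * (s\<^sup>2 - t\<^sup>2) / 2 + \<gamma>y x y"
    by (rule DERIV_unique[OF dy(3)[OF assms, of x s y]])
      (auto intro!: derivative_eq_intros deriv_coeffs simp: S_eq assms)
qed

lemma Bs_eq:
  assumes "t > 0"
  shows "4 * t^3 * Bs x y s t = - (Sy x y s t + s * Sx x y s t)"
  using xs[OF assms, of x y s] ys[OF assms, of s x y] by algebra

lemma Bt_eq:
  assumes "t > 0"
  shows "4 * t^3 * Bt x y s t = - (Ty x y s t + s * Tx x y s t)"
  using xt[OF assms, of x y s] yt[OF assms, of s x y] by algebra

lemma B_eq_t:
  assumes "t > 0"
  shows "B x y s t - B x y s 1 =
    (\<alpha>y x y + s * (\<beta>y x y + \<alpha>x x y) + s\<^sup>2 * \<beta>x x y) / 4 * (1 / t - 1)"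
proof -
  define k where "k = (\<alpha>y x y + s * (\<beta>y x y + \<alpha>x x y) + s\<^sup>2 * \<beta>x x y) / 4"
  have "B x y s t - B x y s 1 = k / t - k / 1"
  proof (rule same_derivative_pos[OF _ _ assms])
    fix t :: real assume t: "t > 0"
    have "4 * t^3 * Bt x y s t = 4 * t^3 * (- k / t\<^sup>2)"
      using t unfolding Bt_eq[OF t] deriv_ST[OF t] k_def
      by (simp add: field_simps power2_eq_square power3_eq_cube)
    then have "Bt x y s t = - k / t\<^sup>2" using t by (subst (asm) mult_cancel_left) simp
    then show "((\<lambda>t. B x y s t) has_real_derivative - k / t\<^sup>2) (at t)"
      using dt(2)[OF t, of x y s] by simp
    show "((\<lambda>t. k / t) has_real_derivative - k / t\<^sup>2) (at t)"
      using t by (auto intro!: derivative_eq_intros simp: power2_eq_square)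
  qed
  then show ?thesis unfolding k_def[symmetric] by (simp add: algebra_simps)
qed

lemma Bs_eq_t:
  assumes t: "t > 0"
  shows "t^3 * (4 * Bs x y s 1 - (\<beta>y x y + \<alpha>x x y + 2 * s * \<beta>x x y))
      + t\<^sup>2 * (\<beta>y x y / 2 + \<alpha>x x y + 3 / 2 * s * \<beta>x x y)
      + (\<gamma>y x y + s * (\<alpha>y x y + \<gamma>x x y) + s\<^sup>2 * (\<beta>y x y / 2 + \<alpha>x x y) + s^3 * \<beta>x x y / 2) = 0"
proof -
  have "((\<lambda>s. B x y s 1 + (\<alpha>y x y + s * (\<beta>y x y + \<alpha>x x y) + s\<^sup>2 * \<beta>x x y) / 4 * (1 / t - 1))
     has_real_derivative Bs x y s 1 + (\<beta>y x y + \<alpha>x x y + 2 * s * \<beta>x x y) / 4 * (1 / t - 1)) (at s)"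
    by (auto intro!: derivative_eq_intros ds)
  moreover have "B x y s 1 + (\<alpha>y x y + s * (\<beta>y x y + \<alpha>x x y) + s\<^sup>2 * \<beta>x x y) / 4 * (1 / t - 1)
     = B x y s t" for s
    using B_eq_t[OF t, of x y s] by linarith
  ultimately have "Bs x y s t = Bs x y s 1 + (\<beta>y x y + \<alpha>x x y + 2 * s * \<beta>x x y) / 4 * (1 / t - 1)"
    using DERIV_unique[OF ds(2)[OF t, of x y s]] by simp
  then have "t * Bs x y s t = t * Bs x y s 1 + (\<beta>y x y + \<alpha>x x y + 2 * s * \<beta>x x y) / 4 * (1 - t)"
    using t by (simp add: field_simps)
  then have "4 * t\<^sup>2 * (t * Bs x y s t) = 4 * t\<^sup>2 *
      (t * Bs x y s 1 + (\<beta>y x y + \<alpha>x x y + 2 * s * \<beta>x x y) / 4 * (1 - t))"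
    by simp
  moreover have "4 * t\<^sup>2 * (t * Bs x y s t) = - (Sy x y s t + s * Sx x y s t)"
    using Bs_eq[OF t, of x y s] by (simp add: power2_eq_square power3_eq_cube mult.assoc)
  ultimately have "4 * t\<^sup>2 * (t * Bs x y s 1 + (\<beta>y x y + \<alpha>x x y + 2 * s * \<beta>x x y) / 4 * (1 - t))
      = - (Sy x y s t + s * Sx x y s t)" by simp
  then show ?thesis
    unfolding deriv_ST[OF t]
    by (simp add: algebra_simps power2_eq_square power3_eq_cube add_divide_distrib diff_divide_distrib)
qed

lemma deriv_coeff_relations:
  "\<beta>x x y = 0" "\<alpha>x x y = - \<beta>y x y / 2" "\<gamma>y x y = 0" "\<gamma>x x y = - \<alpha>y x y"
  "4 * Bs x y s 1 = \<beta>y x y / 2"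
proof -
  have *: "p = 0 \<and> q = 0 \<and> r = 0" if "\<And>t. t > 0 \<Longrightarrow> t^3 * p + t\<^sup>2 * q + r = 0" for p q r :: real
    using that[of 1] that[of 2] that[of 3] by simp
  have c: "4 * Bs x y s 1 - (\<beta>y x y + \<alpha>x x y + 2 * s * \<beta>x x y) = 0"
    "\<beta>y x y / 2 + \<alpha>x x y + 3 / 2 * s * \<beta>x x y = 0"
    "\<gamma>y x y + s * (\<alpha>y x y + \<gamma>x x y) + s\<^sup>2 * (\<beta>y x y / 2 + \<alpha>x x y) + s^3 * \<beta>x x y / 2 = 0" for s
    using *[OF Bs_eq_t] by blast+
  show 1: "\<beta>x x y = 0" "\<alpha>x x y = - \<beta>y x y / 2" using c(2)[of 0] c(2)[of 1] by auto
  show "\<gamma>y x y = 0" using c(3)[of 0] by simp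
  show "\<gamma>x x y = - \<alpha>y x y" using c(3)[of 0] c(3)[of 1] 1 by simp
  show "4 * Bs x y s 1 = \<beta>y x y / 2" using c(1)[of s] 1 by simp
qed

definition A0 where "A0 x y = A x y 0 1 - \<beta>y x y / 8"
definition B0 where "B0 x y = B x y 0 1 - \<alpha>y x y / 4"

lemma B_eq:
  assumes "t > 0"
  shows "B x y s t = B0 x y + (\<alpha>y x y + s * \<beta>y x y / 2) / (4 * t)"
proof -
  have "B x y s 1 - B x y 0 1 = \<beta>y x y / 8 * s - \<beta>y x y / 8 * 0"
  proof (rule same_derivative)
    show "((\<lambda>s. B x y s 1) has_real_derivative \<beta>y x y / 8) (at s)" for s
    proof -
      have "Bs x y s 1 = \<beta>y x y / 8" using deriv_coeff_relations(5)[of x y s] by simp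
      then show ?thesis using ds(2)[of 1 x y s] by (simp only: zero_less_one)
    qed
  qed (auto intro!: derivative_eq_intros)
  then show ?thesis
    using B_eq_t[OF assms, of x y s] assms
    by (simp add: B0_def deriv_coeff_relations field_simps)
qed

lemma A_eq:
  assumes t: "t > 0"
  shows "A x y s t = A0 x y + \<beta>y x y * t / 8 + (\<alpha>y x y * s + \<beta>y x y * s\<^sup>2 / 2) / (4 * t)"
proof -
  have 1: "A x y 0 t - A x y 0 1 = \<beta>y x y / 8 * t - \<beta>y x y / 8 * 1"
  proof (rule same_derivative_pos[OF _ _ t])
    fix t :: real assume t: "t > 0"
    have "At x y 0 t = \<beta>y x y / 8"
      using xt[OF t, of x y 0] t by (simp add: deriv_ST[OF t] deriv_coeff_relations)
    then show "((\<lambda>t. A x y 0 t) has_real_derivative \<beta>y x y / 8) (at t)"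
      using dt(1)[OF t, of x y 0] by (simp only:)
  qed (auto intro!: derivative_eq_intros)
  have "A x y s t - A x y 0 t = (\<alpha>y x y * s + \<beta>y x y * s\<^sup>2 / 2) / (4 * t)
      - (\<alpha>y x y * 0 + \<beta>y x y * 0\<^sup>2 / 2) / (4 * t)"
  proof (rule same_derivative)
    fix s
    have "((\<lambda>s. B x y s t) has_real_derivative \<beta>y x y / (8 * t)) (at s)"
      using t by (auto intro!: derivative_eq_intros simp: B_eq)
    then have "Bs x y s t = \<beta>y x y / (8 * t)" using DERIV_unique[OF ds(2)[OF t]] by blast
    then have "As x y s t = (\<alpha>y x y + \<beta>y x y * s) / (4 * t)"
      using xs[OF t, of x y s] t by (simp add: deriv_ST[OF t] deriv_coeff_relations field_simps)
    then show "((\<lambda>s. A x y s t) has_real_derivative (\<alpha>y x y + \<beta>y x y * s) / (4 * t)) (at s)"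
      using ds(1)[OF t, of x y s] by simp
  qed (use t in \<open>auto intro!: derivative_eq_intros simp: field_simps\<close>)
  with 1 show ?thesis unfolding A0_def by simp
qed

text \<open>
  Differentiability of \<open>\<alpha>y\<close> and \<open>\<beta>y\<close> is not available here, so their contributions to \<open>A\<close> and \<open>B\<close> are
  eliminated by combining values at several points \<open>(s, t)\<close>.
\<close>

lemma deriv_0x:
  "((\<lambda>x. A0 x y) has_real_derivative \<alpha> x y / 2 - 6) (at x)"
  "((\<lambda>x. B0 x y) has_real_derivative - \<beta> x y / 2) (at x)"
proof -
  have W: "((\<lambda>x. A x y s t - s * B x y s t) has_real_derivative (\<alpha> x y + \<beta> x y * s) / 2 - 6) (at x)"
    if t: "t > 0" for s t
  proof -
    have "t * (Ax x y s t - s * Bx x y s t) = t * ((\<alpha> x y + \<beta> x y * s) / 2 - 6)"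
      using xx[OF t, of x y s] unfolding T_eq[OF t] mu_eq by (simp add: field_simps)
    then have "Ax x y s t - s * Bx x y s t = (\<alpha> x y + \<beta> x y * s) / 2 - 6" using t by simp
    moreover have "((\<lambda>x. A x y s t - s * B x y s t) has_real_derivative
        Ax x y s t - s * Bx x y s t) (at x)"
      by (intro DERIV_diff DERIV_cmult dx t)
    ultimately show ?thesis by (simp only:)
  qed
  have "((\<lambda>x. 2 * (A x y 0 1 - 0 * B x y 0 1) - (A x y 0 2 - 0 * B x y 0 2)) has_real_derivative
     2 * ((\<alpha> x y + \<beta> x y * 0) / 2 - 6) - ((\<alpha> x y + \<beta> x y * 0) / 2 - 6)) (at x)"
    by (intro DERIV_diff DERIV_cmult W) auto
  then show "((\<lambda>x. A0 x y) has_real_derivative \<alpha> x y / 2 - 6) (at x)"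
    by (simp add: A_eq)
  have "((\<lambda>x. (A x y 0 1 - 0 * B x y 0 1) - (A x y 1 1 - 1 * B x y 1 1)) has_real_derivative
     ((\<alpha> x y + \<beta> x y * 0) / 2 - 6) - ((\<alpha> x y + \<beta> x y * 1) / 2 - 6)) (at x)"
    by (intro DERIV_diff W) auto
  then show "((\<lambda>x. B0 x y) has_real_derivative - \<beta> x y / 2) (at x)"
    by (simp add: A_eq B_eq add_divide_distrib)
qed

lemma deriv_0y:
  "((\<lambda>y. A0 x y) has_real_derivative \<gamma> x y) (at y)"
  "((\<lambda>y. B0 x y) has_real_derivative - \<alpha> x y / 2 - 6) (at y)"
proof -
  have V: "((\<lambda>y. (s\<^sup>2 + t\<^sup>2) * B x y s t - s * A x y s t) has_real_derivative
      (- \<alpha> x y / 2 - 6) * (s\<^sup>2 + t\<^sup>2) - \<gamma> x y * s) (at y)"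
    if t: "t > 0" for s t
  proof -
    have "t * ((s\<^sup>2 + t\<^sup>2) * By x y s t - s * Ay x y s t)
      = t * ((- \<alpha> x y / 2 - 6) * (s\<^sup>2 + t\<^sup>2) - \<gamma> x y * s)"
      using yy[OF t, of s x y] unfolding T_eq[OF t] S_eq[OF t] mu_eq
      by (simp add: field_simps power2_eq_square)
    then have "(s\<^sup>2 + t\<^sup>2) * By x y s t - s * Ay x y s t
      = (- \<alpha> x y / 2 - 6) * (s\<^sup>2 + t\<^sup>2) - \<gamma> x y * s" using t by simp
    moreover have "((\<lambda>y. (s\<^sup>2 + t\<^sup>2) * B x y s t - s * A x y s t) has_real_derivative
        (s\<^sup>2 + t\<^sup>2) * By x y s t - s * Ay x y s t) (at y)"
      by (intro DERIV_diff DERIV_cmult dy t)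
    ultimately show ?thesis by (simp only:)
  qed
  have "((\<lambda>y. (1/2) * (((0\<^sup>2 + 2\<^sup>2) * B x y 0 2 - 0 * A x y 0 2)
        - 2 * ((0\<^sup>2 + 1\<^sup>2) * B x y 0 1 - 0 * A x y 0 1))) has_real_derivative
     (1/2) * (((- \<alpha> x y / 2 - 6) * (0\<^sup>2 + 2\<^sup>2) - \<gamma> x y * 0)
       - 2 * ((- \<alpha> x y / 2 - 6) * (0\<^sup>2 + 1\<^sup>2) - \<gamma> x y * 0))) (at y)"
    by (intro DERIV_diff DERIV_cmult V) auto
  then show B: "((\<lambda>y. B0 x y) has_real_derivative - \<alpha> x y / 2 - 6) (at y)"
    by (simp add: A_eq B_eq diff_divide_distrib)
  have "((\<lambda>y. B0 x y - (((1\<^sup>2 + 1\<^sup>2) * B x y 1 1 - 1 * A x y 1 1)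
        - ((0\<^sup>2 + 1\<^sup>2) * B x y 0 1 - 0 * A x y 0 1))) has_real_derivative
     (- \<alpha> x y / 2 - 6) - (((- \<alpha> x y / 2 - 6) * (1\<^sup>2 + 1\<^sup>2) - \<gamma> x y * 1)
       - ((- \<alpha> x y / 2 - 6) * (0\<^sup>2 + 1\<^sup>2) - \<gamma> x y * 0))) (at y)"
    by (intro DERIV_diff V B) auto
  then show "((\<lambda>y. A0 x y) has_real_derivative \<gamma> x y) (at y)"
    by (simp add: A_eq B_eq field_simps)
qed

lemma \<beta>_const_x: "\<beta> x y = \<beta> 0 y"
  using deriv_coeffs(3)[of y] by (intro DERIV_isconst_all) (simp add: deriv_coeff_relations)

lemma \<gamma>_const_y: "\<gamma> x y = \<gamma> x 0"
  using deriv_coeffs(6)[of x] by (intro DERIV_isconst_all) (simp add: deriv_coeff_relations)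

text \<open>
  The mixed second derivatives of \<open>A0\<close> agree because \<open>\<gamma>\<close> does not depend on \<open>y\<close>, which makes \<open>A0\<close> affine
  in \<open>y\<close>; this gives \<open>\<alpha>y = 2 \<gamma>x\<close>, in contrast to \<open>\<gamma>x = - \<alpha>y\<close>.
\<close>

lemma \<alpha>y_eq_0: "\<alpha>y x y = 0"
proof -
  have A0: "A0 x y = A0 x 0 + \<gamma> x 0 * y" for x y
    by (rule affine_of_const_deriv[of "A0 x" "\<gamma> x 0"], subst \<gamma>_const_y[symmetric], rule deriv_0y(1))
  have \<alpha>: "\<alpha> x y = \<alpha> x 0 + 2 * \<gamma>x x 0 * y" for y
  proof -
    have "((\<lambda>x. A0 x 0 + \<gamma> x 0 * y) has_real_derivative \<alpha> x 0 / 2 - 6 + \<gamma>x x 0 * y) (at x)"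
      by (intro DERIV_add DERIV_cmult_right deriv_0x deriv_coeffs)
    then have "((\<lambda>x. A0 x y) has_real_derivative \<alpha> x 0 / 2 - 6 + \<gamma>x x 0 * y) (at x)"
      by (simp only: A0[symmetric])
    from DERIV_unique[OF deriv_0x(1) this] show ?thesis by simp
  qed
  have "((\<lambda>y. \<alpha> x 0 + 2 * \<gamma>x x 0 * y) has_real_derivative 2 * \<gamma>x x 0) (at y)" for y
    by (auto intro!: derivative_eq_intros)
  then have "((\<lambda>y. \<alpha> x y) has_real_derivative 2 * \<gamma>x x 0) (at y)" for y
    by (simp only: \<alpha>[symmetric])
  then have "\<alpha>y x y = 2 * \<gamma>x x 0" for y using DERIV_unique[OF deriv_coeffs(2)] by blast
  from this[of y] this[of 0] show ?thesis using deriv_coeff_relations(4)[of x 0] by linarith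
qed

lemma \<alpha>x_eq_0: "\<alpha>x x y = 0"
proof -
  have B0: "B0 x y = B0 0 y + - \<beta> 0 y / 2 * x" for x y
    by (rule affine_of_const_deriv[of "\<lambda>x. B0 x y" "- \<beta> 0 y / 2"], subst \<beta>_const_x[symmetric], rule deriv_0x(2))
  have \<alpha>: "\<alpha> x y = \<alpha> 0 y + \<beta>y 0 y * x" for x
  proof -
    have "((\<lambda>y. B0 0 y + - \<beta> 0 y / 2 * x) has_real_derivative
        - \<alpha> 0 y / 2 - 6 + - \<beta>y 0 y / 2 * x) (at y)"
      by (intro DERIV_add DERIV_cmult_right DERIV_cdivide DERIV_minus deriv_0y deriv_coeffs)
    then have "((\<lambda>y. B0 x y) has_real_derivative - \<alpha> 0 y / 2 - 6 + - \<beta>y 0 y / 2 * x) (at y)"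
      by (simp only: B0[symmetric])
    from DERIV_unique[OF deriv_0y(2) this] show ?thesis by simp
  qed
  have "((\<lambda>x. \<alpha> 0 y + \<beta>y 0 y * x) has_real_derivative \<beta>y 0 y) (at x)" for x
    by (auto intro!: derivative_eq_intros)
  then have "((\<lambda>x. \<alpha> x y) has_real_derivative \<beta>y 0 y) (at x)" for x
    by (simp only: \<alpha>[symmetric])
  then have "\<alpha>x x y = \<beta>y 0 y" for x using DERIV_unique[OF deriv_coeffs(1)] by blast
  from this[of x] this[of 0] show ?thesis using deriv_coeff_relations(2)[of 0 y] by linarith
qed

lemma coeffs_const: "\<alpha> x y = \<alpha> 0 0" "\<beta> x y = \<beta> 0 0" "\<gamma> x y = \<gamma> 0 0" "\<beta>y x y = 0"
proof -
  show b: "\<beta>y x y = 0" for x y using deriv_coeff_relations(2)[of x y] \<alpha>x_eq_0 by simp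
  have "\<alpha> x y = \<alpha> 0 y"
    using deriv_coeffs(1)[of y] by (intro DERIV_isconst_all) (simp add: \<alpha>x_eq_0)
  also have "\<dots> = \<alpha> 0 0"
    using deriv_coeffs(2)[of 0] by (intro DERIV_isconst_all) (simp add: \<alpha>y_eq_0)
  finally show "\<alpha> x y = \<alpha> 0 0" .
  have "\<beta> 0 y = \<beta> 0 0"
    using deriv_coeffs(4)[of 0] by (intro DERIV_isconst_all) (simp add: b)
  then show "\<beta> x y = \<beta> 0 0" using \<beta>_const_x by metis
  have "\<gamma> x 0 = \<gamma> 0 0"
    using deriv_coeffs(5)[of 0]
    by (intro DERIV_isconst_all) (simp add: \<alpha>y_eq_0 deriv_coeff_relations)
  then show "\<gamma> x y = \<gamma> 0 0" using \<gamma>_const_y by metis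
qed

lemma A0_eq: "A0 x y = A0 0 0 + \<gamma> 0 0 * y + (\<alpha> 0 0 / 2 - 6) * x"
proof -
  have "A0 x y = A0 0 y + (\<alpha> 0 0 / 2 - 6) * x"
    by (rule affine_of_const_deriv[of "\<lambda>x. A0 x y"], subst coeffs_const(1)[symmetric], rule deriv_0x(1))
  also have "A0 0 y = A0 0 0 + \<gamma> 0 0 * y"
    by (rule affine_of_const_deriv[of "A0 0"], subst coeffs_const(3)[symmetric], rule deriv_0y(1))
  finally show ?thesis .
qed

lemma B0_eq: "B0 x y = B0 0 0 + (- \<alpha> 0 0 / 2 - 6) * y + - \<beta> 0 0 / 2 * x"
proof -
  have "B0 x y = B0 0 y + - \<beta> 0 0 / 2 * x"
    by (rule affine_of_const_deriv[of "\<lambda>x. B0 x y"], subst coeffs_const(2)[symmetric], rule deriv_0x(2))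
  also have "B0 0 y = B0 0 0 + (- \<alpha> 0 0 / 2 - 6) * y"
    by (rule affine_of_const_deriv[of "B0 0"], subst coeffs_const(1)[symmetric], rule deriv_0y(2))
  finally show ?thesis .
qed

lemma solution:
  "\<exists>c1 c2 c3 c4 c5. \<forall>x y s t. t > 0 \<longrightarrow>
     A x y s t = 1/2 * ((c2 - 12) * x + 2 * c3 * y + 2 * c5) \<and>
     B x y s t = - (1/2) * (c1 * x + (c2 + 12) * y - 2 * c4) \<and>
     S x y s t = 1/2 * (c1 * (s\<^sup>2 - t\<^sup>2) + 2 * c2 * s + 2 * c3) \<and>
     T x y s t = (c1 * s + c2) * t"
proof (intro exI allI impI conjI)
  fix x y s t :: real assume t: "t > 0"
  let ?c1 = "\<beta> 0 0" and ?c2 = "\<alpha> 0 0" and ?c3 = "\<gamma> 0 0" and ?c4 = "B0 0 0" and ?c5 = "A0 0 0"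
  show "A x y s t = 1/2 * ((?c2 - 12) * x + 2 * ?c3 * y + 2 * ?c5)"
    unfolding A_eq[OF t] A0_eq[of x y] \<alpha>y_eq_0 coeffs_const(4) by (simp add: algebra_simps)
  show "B x y s t = - (1/2) * (?c1 * x + (?c2 + 12) * y - 2 * ?c4)"
    unfolding B_eq[OF t] B0_eq[of x y] \<alpha>y_eq_0 coeffs_const(4) by (simp add: algebra_simps)
  show "S x y s t = 1/2 * (?c1 * (s\<^sup>2 - t\<^sup>2) + 2 * ?c2 * s + 2 * ?c3)"
    unfolding S_eq[OF t] coeffs_const(1-3)[of x y] by (simp add: field_simps)
  show "T x y s t = (?c1 * s + ?c2) * t"
    unfolding T_eq[OF t] coeffs_const(1-3)[of x y] by (simp add: algebra_simps)
qed

end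

lemma soliton_pde_of_soliton_form:
  assumes \<xi>: "smooth_on F4 \<xi>" and sol: "\<And>p u v. p \<in> F4 \<Longrightarrow> soliton_form \<xi> \<mu> p u v = 0"
  defines "L1 \<equiv> \<lambda>u::pt4. fst u" and "L2 \<equiv> \<lambda>u::pt4. fst (snd u)"
    and "L3 \<equiv> \<lambda>u::pt4. fst (snd (snd u))" and "L4 \<equiv> \<lambda>u::pt4. snd (snd (snd u))"
    and "d \<equiv> \<lambda>L v x y s t. L (frechet_derivative \<xi> (at (x, y, s, t)) v) :: real"
  shows "soliton_pde (\<lambda>x y s t. L1 (\<xi> (x, y, s, t))) (\<lambda>x y s t. L2 (\<xi> (x, y, s, t)))
    (\<lambda>x y s t. L3 (\<xi> (x, y, s, t))) (\<lambda>x y s t. L4 (\<xi> (x, y, s, t)))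
    (d L1 (1, 0, 0, 0)) (d L1 (0, 1, 0, 0)) (d L1 (0, 0, 1, 0)) (d L1 (0, 0, 0, 1))
    (d L2 (1, 0, 0, 0)) (d L2 (0, 1, 0, 0)) (d L2 (0, 0, 1, 0)) (d L2 (0, 0, 0, 1))
    (d L3 (1, 0, 0, 0)) (d L3 (0, 1, 0, 0)) (d L3 (0, 0, 1, 0)) (d L3 (0, 0, 0, 1))
    (d L4 (1, 0, 0, 0)) (d L4 (0, 1, 0, 0)) (d L4 (0, 0, 1, 0)) (d L4 (0, 0, 0, 1)) \<mu>"
proof -
  have p: "(x, y, s, t) \<in> F4" if "t > 0" for x y s t using that by (simp add: F4_def)
  have bl: "bounded_linear L1" "bounded_linear L2" "bounded_linear L3" "bounded_linear L4"
    unfolding L1_def L2_def L3_def L4_def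
    by (intro bounded_linear_fst_comp bounded_linear_snd_comp bounded_linear_fst bounded_linear_snd
        bounded_linear_ident)+
  note der = partial_derivatives[OF smooth_onD(2)[OF \<xi> p]]
  have tuple: "u = (L1 u, L2 u, L3 u, L4 u)" for u by (simp add: L1_def L2_def L3_def L4_def)
  note form = soliton_form_basis[OF _ tuple tuple tuple tuple tuple, where \<xi> = \<xi> and \<mu> = \<mu>]
  have z: "n = m" if "q = (n - m) / (k * t ^ j)" "q = 0" "t > 0" "k \<noteq> 0" for q n m k t :: real and j
    using that by simp
  have z0: "n = 0" if "q = n / (k * t ^ j)" "q = 0" "t > 0" "k \<noteq> 0" for q n k t :: real and j
    using that by simp
  show ?thesis
    by unfold_locales
      (use bl in \<open>auto simp: d_def intro!: der z[OF form(1) sol[OF p]] z[OF form(3) sol[OF p]] z0[OF form(4) sol[OF p]] z0[OF form(5) sol[OF p]]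
        z0[OF form(6) sol[OF p]] z0[OF form(7) sol[OF p]] z[OF form(8) sol[OF p]] z0[OF form(9) sol[OF p]] z[OF form(10) sol[OF p]]\<close>)
qed

lemma soliton_form_sym: "soliton_form \<xi> \<mu> p u v = soliton_form \<xi> \<mu> p v u"
proof -
  have "gF4 p (0, 0, - 6 * fst (snd (snd u)), - 6 * snd (snd (snd u))) v
      = gF4 p (0, 0, - 6 * fst (snd (snd v)), - 6 * snd (snd (snd v))) u"
    unfolding gF4_def theta1_def theta2_def theta3_def theta4_def case_prod_beta by (simp add: mult_ac)
  then show ?thesis by (simp add: soliton_form_def gF4_sym)
qed

lemma linear_soliton_form:
  assumes "\<xi> differentiable (at p)"
  shows "linear (\<lambda>u. soliton_form \<xi> \<mu> p u v)"
proof -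
  interpret F: linear "frechet_derivative \<xi> (at p)"
    using assms by (rule linear_frechet_derivative)
  have scale: "gF4 p (r *\<^sub>R w) w' = r * gF4 p w w'" for r w w'
    unfolding gF4_def theta1_def theta2_def theta3_def theta4_def case_prod_beta
    by (simp add: algebra_simps)
  have "linear (\<lambda>u. gF4 p (0, 0, - 6 * fst (snd (snd u)), - 6 * snd (snd (snd u))) v)"
    unfolding gF4_def theta1_def theta2_def theta3_def theta4_def case_prod_beta
    by (rule linearI) (simp_all add: algebra_simps)
  moreover have "linear (\<lambda>u. gF4 p (frechet_derivative \<xi> (at p) u + GammaF4 p u (\<xi> p)) v)"
    by (rule linearI)
      (simp_all add: F.add F.scale GammaF4_add GammaF4_scaleR gF4_bilinear(1) scale scaleR_add_right[symmetric])
  moreover have "linear (\<lambda>u. gF4 p u w)" for w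
    by (rule linearI) (simp_all add: gF4_bilinear scale)
  moreover have scaled: "linear (\<lambda>u. k * f u)" if "linear f" for k and f :: "pt4 \<Rightarrow> real"
    using linear_compose_scale_right[OF that, of k] by simp
  ultimately show ?thesis
    unfolding soliton_form_def
    by (intro linear_compose_add linear_compose_sub scaled)
qed

lemma linear_eq_0_on_basis:
  fixes f :: "pt4 \<Rightarrow> real"
  assumes "linear f" "f (1, 0, 0, 0) = 0" "f (0, 1, 0, 0) = 0" "f (0, 0, 1, 0) = 0" "f (0, 0, 0, 1) = 0"
  shows "f u = 0"
proof -
  interpret linear f by (rule assms(1))
  obtain a b c d where u: "u = (a, b, c, d)" by (metis prod_cases4)
  have "f u = f (a *\<^sub>R (1, 0, 0, 0) + b *\<^sub>R (0, 1, 0, 0) + c *\<^sub>R (0, 0, 1, 0) + d *\<^sub>R (0, 0, 0, 1))"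
    by (simp add: u)
  also have "\<dots> = 0" by (simp only: add scale assms) simp
  finally show ?thesis .
qed

lemma soliton_form_solution:
  assumes \<xi>: "\<And>x y s t. t > 0 \<Longrightarrow>
    \<xi> (x, y, s, t) =
      (1/2 * ((c2 - 12) * x + 2 * c3 * y + 2 * c5),
       - (1/2) * (c1 * x + (c2 + 12) * y - 2 * c4),
       1/2 * (c1 * (s\<^sup>2 - t\<^sup>2) + 2 * c2 * s + 2 * c3),
       (c1 * s + c2) * t)"
    and p: "p \<in> F4"
  shows "soliton_form \<xi> (-6) p u v = 0"
proof -
  obtain x y s t where xyst: "p = (x, y, s, t)" and t: "t > 0" using p by (auto simp: F4_def)
  let ?h = "\<lambda>q. (1/2 * ((c2 - 12) * fst q + 2 * c3 * fst (snd q) + 2 * c5),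
       - (1/2) * (c1 * fst q + (c2 + 12) * fst (snd q) - 2 * c4),
       1/2 * (c1 * ((fst (snd (snd q)))\<^sup>2 - (snd (snd (snd q)))\<^sup>2) + 2 * c2 * fst (snd (snd q)) + 2 * c3),
       (c1 * fst (snd (snd q)) + c2) * snd (snd (snd q)))"
  have "(?h has_derivative (\<lambda>(a, b, c, d). (1/2 * ((c2 - 12) * a + 2 * c3 * b),
       - (1/2) * (c1 * a + (c2 + 12) * b), c1 * (s * c - t * d) + c2 * c,
       c1 * c * t + (c1 * s + c2) * d))) (at p)"
    unfolding xyst case_prod_beta
    by (auto intro!: derivative_eq_intros simp: fun_eq_iff algebra_simps)
  then have D: "(\<xi> has_derivative (\<lambda>(a, b, c, d). (1/2 * ((c2 - 12) * a + 2 * c3 * b),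
       - (1/2) * (c1 * a + (c2 + 12) * b), c1 * (s * c - t * d) + c2 * c,
       c1 * c * t + (c1 * s + c2) * d))) (at p)"
    by (rule has_derivative_transform_within_open[OF _ open_F4 p]) (auto simp: F4_def \<xi>)
  then have diff: "\<xi> differentiable (at p)" by (rule differentiableI)
  note F = frechet_derivative_at[OF D, symmetric, unfolded xyst]
  note lin = linear_eq_0_on_basis[OF linear_soliton_form[OF diff]]
  note B = soliton_form_basis[OF t \<xi>[OF t]
      F[THEN fun_cong, of "(1, 0, 0, 0)", unfolded prod.case]
      F[THEN fun_cong, of "(0, 1, 0, 0)", unfolded prod.case]
      F[THEN fun_cong, of "(0, 0, 1, 0)", unfolded prod.case]
      F[THEN fun_cong, of "(0, 0, 0, 1)", unfolded prod.case]]
  have basis: "soliton_form \<xi> (-6) p u v = 0"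
    if "u \<in> {(1, 0, 0, 0), (0, 1, 0, 0), (0, 0, 1, 0), (0, 0, 0, 1)}"
      "v \<in> {(1, 0, 0, 0), (0, 1, 0, 0), (0, 0, 1, 0), (0, 0, 0, 1)}" for u v
  proof -
    note S = soliton_form_sym[of \<xi> _ _ "(0, 1, 0, 0)" "(1, 0, 0, 0)"]
      soliton_form_sym[of \<xi> _ _ "(0, 0, 1, 0)" "(1, 0, 0, 0)"]
      soliton_form_sym[of \<xi> _ _ "(0, 0, 1, 0)" "(0, 1, 0, 0)"]
      soliton_form_sym[of \<xi> _ _ "(0, 0, 0, 1)" "(1, 0, 0, 0)"]
      soliton_form_sym[of \<xi> _ _ "(0, 0, 0, 1)" "(0, 1, 0, 0)"]
      soliton_form_sym[of \<xi> _ _ "(0, 0, 0, 1)" "(0, 0, 1, 0)"]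
    show ?thesis
      using that unfolding xyst insert_iff empty_iff
      by (elim disjE FalseE; hypsubst; simp only: B S; simp add: field_simps power2_eq_square)
  qed
  have half: "soliton_form \<xi> (-6) p u v = 0"
    if "v \<in> {(1, 0, 0, 0), (0, 1, 0, 0), (0, 0, 1, 0), (0, 0, 0, 1)}" for u v
    by (rule lin; rule basis[OF _ that]; simp)
  show ?thesis
    unfolding soliton_form_sym[of \<xi> "-6" p u v]
    by (rule lin; subst soliton_form_sym; rule half; simp)
qed

theorem theorem2p1:
  fixes D :: "pt4 vfield \<Rightarrow> pt4 vfield \<Rightarrow> pt4 vfield"
    and \<xi> :: "pt4 vfield"
  assumes LC: "levi_civita F4 gF4 D"
    and smooth: "smooth_on F4 \<xi>"
  shows "((\<exists>\<mu>. ricci_soliton F4 gF4 D frameF4 \<xi> \<mu>) \<longleftrightarrow>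
          (\<exists>c1 c2 c3 c4 c5 :: real. \<forall>x y s t. t > 0 \<longrightarrow>
             \<xi> (x, y, s, t) =
               (1/2 * ((c2 - 12) * x + 2 * c3 * y + 2 * c5),
                - (1/2) * (c1 * x + (c2 + 12) * y - 2 * c4),
                1/2 * (c1 * (s^2 - t^2) + 2 * c2 * s + 2 * c3),
                (c1 * s + c2) * t)))
       \<and> (\<forall>\<mu>. ricci_soliton F4 gF4 D frameF4 \<xi> \<mu> \<longrightarrow>
             expanding_ricci_soliton F4 gF4 D frameF4 \<xi> \<mu> \<and> \<mu> = -6)"
proof -
  note iff = ricci_soliton_iff[OF LC smooth]
  have pde: "\<mu> = -6 \<and> (\<exists>c1 c2 c3 c4 c5 :: real. \<forall>x y s t. t > 0 \<longrightarrow>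
             \<xi> (x, y, s, t) =
               (1/2 * ((c2 - 12) * x + 2 * c3 * y + 2 * c5),
                - (1/2) * (c1 * x + (c2 + 12) * y - 2 * c4),
                1/2 * (c1 * (s^2 - t^2) + 2 * c2 * s + 2 * c3),
                (c1 * s + c2) * t))" if "ricci_soliton F4 gF4 D frameF4 \<xi> \<mu>" for \<mu>
  proof -
    have "soliton_form \<xi> \<mu> p u v = 0" if "p \<in> F4" for p u v
      using \<open>ricci_soliton F4 gF4 D frameF4 \<xi> \<mu>\<close> that unfolding iff by blast
    note pde = soliton_pde_of_soliton_form[OF smooth this]
    show ?thesis
      using soliton_pde.mu_eq[OF pde] soliton_pde.solution[OF pde] by (simp add: prod_eq_iff)
  qed
  have converse: "\<exists>\<mu>. ricci_soliton F4 gF4 D frameF4 \<xi> \<mu>"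
    if "\<forall>x y s t. t > 0 \<longrightarrow>
             \<xi> (x, y, s, t) =
               (1/2 * ((c2 - 12) * x + 2 * c3 * y + 2 * c5),
                - (1/2) * (c1 * x + (c2 + 12) * y - 2 * c4),
                1/2 * (c1 * (s^2 - t^2) + 2 * c2 * s + 2 * c3),
                (c1 * s + c2) * t)" for c1 c2 c3 c4 c5
    using soliton_form_solution[of \<xi> c2 c3 c5 c1 c4] that unfolding iff by blast
  show ?thesis
    unfolding expanding_ricci_soliton_def
  proof (intro conjI iffI allI impI)
    fix \<mu> assume sol: "ricci_soliton F4 gF4 D frameF4 \<xi> \<mu>"
    show "\<mu> = -6" "\<mu> < 0" using pde[OF sol] by auto
    show "ricci_soliton F4 gF4 D frameF4 \<xi> \<mu>" by (rule sol)
  qed (use pde converse in blast)+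
qed

end
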